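(* Let $\mathbf r,\mathbf a\in\mathbb R^3$ with $|\mathbf a|>|\mathbf r|>0$, and put $\mathbf r'=\mathbf r+\mathbf a$, $r=|\mathbf r|$, $r'=|\mathbf r'|$. For integers $l\ge0$, $|m|\le l$, $\lambda\ge1$, $|\mu|\le\lambda$ let $$H_{l,\lambda}^{m,\mu}(\mathbf a)=(-1)^{\lambda+\mu}\sqrt{\frac{2l+1}{2\lambda+1}}\;I_{l+\lambda}^{m-\mu}(\mathbf a)\sqrt{\binom{l+\lambda+\mu-m}{\lambda+\mu}\binom{l+\lambda+m-\mu}{\lambda-\mu}},$$ and define $$H_{l,\lambda}^{[m],\mu}=\begin{cases}\frac1{\sqrt2}\big(H_{l,\lambda}^{-m,\mu}(\mathbf a)+(-1)^mH_{l,\lambda}^{m,\mu}(\mathbf a)\big),&m>0,\\ H_{l,\lambda}^{0,\mu}(\mathbf a),&m=0,\\ \frac{i}{\sqrt2}\big(H_{l,\lambda}^{m,\mu}(\mathbf a)-(-1)^mH_{l,\lambda}^{-m,\mu}(\mathbf a)\big),&m<0.\end{cases}$$ Then for all $l\ge0$ and $|m|\le l$ the real vector spherical harmonic $V_{lm}$ satisfies $$r'^{-l-2}V_{lm}(\hat{\mathbf r}')=\sum_{\lambda=1}^{\infty}\sum_{\mu=-\lambda}^{\lambda}r^{\lambda-1}H_{l,\lambda}^{[m],\mu}\,W_\lambda^\mu(\hat{\mathbf r})$$ $$=\sum_{\lambda=1}^{\infty}r^{\lambda-1}\Big\{\sum_{\mu=-\lambda}^{-1}\tfrac1{\sqrt2}H_{l,\lambda}^{[m],\mu}\big[W_{\lambda,-\mu}(\hat{\mathbf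 r})-iW_{\lambda,\mu}(\hat{\mathbf r})\big]+\sum_{\mu=1}^{\lambda}\tfrac{(-1)^\mu}{\sqrt2}H_{l,\lambda}^{[m],\mu}\big[W_{\lambda,\mu}(\hat{\mathbf r})+iW_{\lambda,-\mu}(\hat{\mathbf r})\big]+H_{l,\lambda}^{[m],0}W_{\lambda,0}(\hat{\mathbf r})\Big\}.$$
   Context: For nonzero $\mathbf r$, $\hat{\mathbf r}=\mathbf r/|\mathbf r|$. $Y_l^m$ ($l\ge0$, $|m|\le l$) are the standard $L^2$-orthonormal complex spherical harmonics on the unit sphere with Condon–Shortley phase. Real spherical harmonics: $Y_{lm}=\frac1{\sqrt2}(Y_l^{-m}+(-1)^mY_l^m)$ for $m>0$, $Y_{l0}=Y_l^0$, $Y_{lm}=\frac{i}{\sqrt2}(Y_l^m-(-1)^mY_l^{-m})$ for $m<0$. With $\nabla_S$ the surface gradient on the unit sphere, the real vector spherical harmonics are $V_{lm}=\nabla_SY_{lm}-(l+1)Y_{lm}\hat{\mathbf r}$, $W_{lm}=\nabla_SY_{lm}+lY_{lm}\hat{\mathbf r}$; the complex ones $V_l^m,W_l^m$ are given by the same formulas with $Y_l^m$ in place of $Y_{lm}$. Irregular solid harmonics: $I_l^m(\mathbf r)=\sqrt{\frac{4\pi}{2l+1}}\,\frac{Y_l^m(\hat{\mathbf r})}{|\mathbf r|^{l+1}}$. The infinite sum over $\lambda$ is the limit of partial sums (the inner sum being finite). *)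

theory Defs
  imports "HOL-Analysis.Analysis" "HOL-Computational_Algebra.Polynomial"
begin

(* Rodrigues' formula. *)
definition legendre_poly :: "nat \<Rightarrow> real poly" where
  "legendre_poly l = smult (1 / (2 ^ l * fact l)) ((pderiv ^^ l) ([:-1, 0, 1:] ^ l))"

(* The factor (-1)^m is the Condon-Shortley phase. *)
definition assoc_legendre :: "nat \<Rightarrow> nat \<Rightarrow> real \<Rightarrow> real" where
  "assoc_legendre l m z =
     (-1) ^ m * sqrt (1 - z\<^sup>2) ^ m * poly ((pderiv ^^ m) (legendre_poly l)) z"

definition sph_harm_ang :: "nat \<Rightarrow> nat \<Rightarrow> real \<Rightarrow> real \<Rightarrow> complex" where
  "sph_harm_ang l m \<theta> \<phi> =
     of_real (sqrt ((2 * real l + 1) / (4 * pi) * (fact (l - m) / fact (l + m)))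
              * assoc_legendre l m (cos \<theta>)) * cis (real m * \<phi>)"

(* The functions on the sphere below are total on real ^ 3 but are meant for unit vectors;
   the polar angle is arccos of the third coordinate.  At the poles the azimuth is irrelevant,
   because assoc_legendre l m vanishes at 1 and -1 for m > 0. *)
definition sph_harm :: "nat \<Rightarrow> int \<Rightarrow> real ^ 3 \<Rightarrow> complex" where
  "sph_harm l m x =
     (let \<theta> = arccos (x $ 3); \<phi> = Arg (Complex (x $ 1) (x $ 2)) in
      if m \<ge> 0 then sph_harm_ang l (nat m) \<theta> \<phi>
      else (-1) powi m * cnj (sph_harm_ang l (nat (- m)) \<theta> \<phi>))"

(* The passage from a family indexed by complex-harmonic orders to the real convention;
   it is used both for the harmonics themselves and for the expansion coefficients. *)
definition real_comb :: "(int \<Rightarrow> complex) \<Rightarrow> int \<Rightarrow> complex" where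
  "real_comb F m =
     (if m > 0 then 1 / of_real (sqrt 2) * (F (- m) + (-1) powi m * F m)
      else if m = 0 then F 0
      else \<i> / of_real (sqrt 2) * (F m - (-1) powi m * F (- m)))"

(* Real-valued on the unit sphere, but kept complex-typed so that it can be combined
   with complex coefficients. *)
definition real_sph_harm :: "nat \<Rightarrow> int \<Rightarrow> real ^ 3 \<Rightarrow> complex" where
  "real_sph_harm l m x = real_comb (\<lambda>k. sph_harm l k x) m"

(* The surface gradient of f at a unit vector x is the ordinary gradient at x of the
   extension of f that is constant along rays; this gradient is tangential to the sphere. *)
definition surface_grad :: "(real ^ 3 \<Rightarrow> complex) \<Rightarrow> real ^ 3 \<Rightarrow> complex ^ 3" where
  "surface_grad f x =
     (\<chi> i. frechet_derivative (\<lambda>y. f (sgn y)) (at x) (axis i 1))"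

definition cvec :: "real ^ 3 \<Rightarrow> complex ^ 3" where
  "cvec x = (\<chi> i. of_real (x $ i))"

definition vec_V :: "nat \<Rightarrow> (real ^ 3 \<Rightarrow> complex) \<Rightarrow> real ^ 3 \<Rightarrow> complex ^ 3" where
  "vec_V l f x = surface_grad f x - ((of_nat l + 1) * f x) *s cvec x"

definition vec_W :: "nat \<Rightarrow> (real ^ 3 \<Rightarrow> complex) \<Rightarrow> real ^ 3 \<Rightarrow> complex ^ 3" where
  "vec_W l f x = surface_grad f x + (of_nat l * f x) *s cvec x"

definition real_V :: "nat \<Rightarrow> int \<Rightarrow> real ^ 3 \<Rightarrow> complex ^ 3" where
  "real_V l m = vec_V l (real_sph_harm l m)"

definition real_W :: "nat \<Rightarrow> int \<Rightarrow> real ^ 3 \<Rightarrow> complex ^ 3" where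
  "real_W l m = vec_W l (real_sph_harm l m)"

definition complex_W :: "nat \<Rightarrow> int \<Rightarrow> real ^ 3 \<Rightarrow> complex ^ 3" where
  "complex_W l m = vec_W l (sph_harm l m)"

definition irreg_solid :: "nat \<Rightarrow> int \<Rightarrow> real ^ 3 \<Rightarrow> complex" where
  "irreg_solid l m x =
     of_real (sqrt (4 * pi / (2 * real l + 1))) * sph_harm l m (sgn x)
     / of_real (norm x ^ (l + 1))"

(* For |m| <= l and |mu| <= lambda all arguments of nat are nonnegative. *)
definition H_coeff :: "nat \<Rightarrow> nat \<Rightarrow> int \<Rightarrow> int \<Rightarrow> real ^ 3 \<Rightarrow> complex" where
  "H_coeff l \<Lambda> m \<mu> a =
     (-1) powi (int \<Lambda> + \<mu>)
     * of_real (sqrt ((2 * real l + 1) / (2 * real \<Lambda> + 1)))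
     * irreg_solid (l + \<Lambda>) (m - \<mu>) a
     * of_real (sqrt (real (nat (int l + int \<Lambda> + \<mu> - m) choose nat (int \<Lambda> + \<mu>))
                    * real (nat (int l + int \<Lambda> + m - \<mu>) choose nat (int \<Lambda> - \<mu>))))"

definition H_real :: "nat \<Rightarrow> nat \<Rightarrow> int \<Rightarrow> int \<Rightarrow> real ^ 3 \<Rightarrow> complex" where
  "H_real l \<Lambda> m \<mu> a = real_comb (\<lambda>k. H_coeff l \<Lambda> k \<mu> a) m"

end

theory Submission imports Defs "HOL-Complex_Analysis.Cauchy_Integral_Formula" begin

text \<open>
  Up to normalisation, \<^term>\<open>vec_W\<close> of a spherical harmonic is the gradient of the regular solid
  harmonic \<open>r\<^sup>l Y\<close>, and \<^term>\<open>vec_V\<close> is the gradient of the irregular one \<open>r\<^sup>-\<^sup>l\<^sup>-\<^sup>1 Y\<close>. The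
  expansion is therefore the gradient of the classical scalar translation formula
    \<open>I_l^m(r + a) = \<Sum>n. \<Sum>\<mu> = -n..n. (-1)^(n + \<mu>) R_n^\<mu>(r) I_{l + n}^{m - \<mu>}(a)\<close>,
  with suitably normalised \<open>R\<close> and \<open>I\<close>. The normalisation is chosen so that differentiation only
  shifts indices, with coefficients \<open>\<plusminus>1\<close> in the directions \<open>\<partial>\<^sub>z\<close> and \<open>\<partial>\<^sub>x \<plusminus> i \<partial>\<^sub>y\<close>
  (\<open>has_derivative_solid\<close>, \<open>has_derivative_solid_irreg\<close>).

  These ladder relations do two jobs. First, they give the Taylor coefficients of
  \<open>t \<mapsto> I_l^m(a + t r)\<close>: the \<open>n\<close>-th derivative is \<open>n!\<close> times the inner sum of the translation formula,
  because the recurrence that raises the degree of \<open>R\<close> is precisely what the directional derivative of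
  \<open>I\<close> produces after an index shift (\<open>ladder_sum\<close>, \<open>translation_derivative\<close>). The function of
  \<open>t\<close> extends holomorphically to the complex disc of radius \<open>|a| / |r| > 1\<close>, since the two complex zeros
  of \<open>|a + t r|\<^sup>2\<close> have that modulus (\<open>radial_branch\<close>), so its Taylor series converges at \<open>t = 1\<close>
  (\<open>irregular_translation\<close>).

  Second, they make termwise differentiation of the series unnecessary: every directional derivative of
  \<open>I_l^m\<close> is a combination of three harmonics \<open>I_{l + 1}\<close>, each of which has its own translation
  series, and the same index shift turns the combination of these three series into the series of
  gradients of \<open>R\<close> (\<open>complex_expansion\<close>). What remains is the identification of \<open>R\<close> and
  \<open>I\<close> with the spherical harmonics given by Rodrigues' formula, the bookkeeping of normalisation
  constants, and the linear passage to real harmonics.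
\<close>

section \<open>Regular solid harmonics as polynomials\<close>

lemma of_nat_add_1_neq_0: "(of_nat n + 1 :: complex) \<noteq> 0"
  by (metis of_nat_Suc of_nat_eq_0_iff nat.distinct(1) add.commute)

text \<open>
  The coefficient of \<open>t\<^sup>m\<close> in \<open>(z - p t / 2 + q / (2 t))\<^sup>l / l!\<close>. For \<open>p = x + i y\<close> and
  \<open>q = x - i y\<close> the base of the power is a linear form with isotropic coefficient vector, so this is a
  harmonic polynomial, namely the regular solid harmonic. Keeping \<open>p\<close> and \<open>q\<close> independent allows
  complex points, which the Taylor argument needs.
\<close>

primrec solid :: "nat \<Rightarrow> int \<Rightarrow> complex \<Rightarrow> complex \<Rightarrow> complex \<Rightarrow> complex" where
  "solid 0 m z p q = (if m = 0 then 1 else 0)"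
| "solid (Suc l) m z p q =
     (z * solid l m z p q - p / 2 * solid l (m - 1) z p q + q / 2 * solid l (m + 1) z p q)
     / (of_nat l + 1)"

text \<open>The solid harmonic of degree one less. Having it vanish at degree 0 makes the identities below uniform in
the degree.\<close>

definition lower :: "nat \<Rightarrow> int \<Rightarrow> complex \<Rightarrow> complex \<Rightarrow> complex \<Rightarrow> complex" where
  "lower l m z p q = (case l of 0 \<Rightarrow> 0 | Suc k \<Rightarrow> solid k m z p q)"

lemma lower_0 [simp]: "lower 0 m z p q = 0"
  and lower_Suc [simp]: "lower (Suc l) m z p q = solid l m z p q"
  by (simp_all add: lower_def)

text \<open>Euler's identity for a homogeneous polynomial, the partial derivatives being written as lower harmonics.\<close>

lemma degree_solid:
  "of_nat l * solid l m z p q =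
     z * lower l m z p q - p / 2 * lower l (m - 1) z p q + q / 2 * lower l (m + 1) z p q"
proof (cases l)
  case (Suc k)
  have "(of_nat k + 1 :: complex) \<noteq> 0"
    by (rule of_nat_add_1_neq_0)
  then show ?thesis using Suc by (simp add: add.commute)
qed simp

lemma solid_Suc':
  "(of_nat l + 1) * solid (Suc l) m z p q =
     z * solid l m z p q - p / 2 * solid l (m - 1) z p q + q / 2 * solid l (m + 1) z p q"
  using degree_solid[of "Suc l" m z p q] by (simp add: add.commute del: solid.simps)

text \<open>The counterpart of Euler's identity for rotations about the axis, under which order \<open>m\<close> is the weight.\<close>

lemma order_solid:
  "of_int m * solid l m z p q = - p / 2 * lower l (m - 1) z p q - q / 2 * lower l (m + 1) z p q"
proof (induction l arbitrary: m)
  case 0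
  then show ?case by simp
next
  case (Suc l)
  note I = Suc.IH[of m] Suc.IH[of "m - 1"] Suc.IH[of "m + 1"]
  note D = degree_solid[of l m z p q] degree_solid[of l "m - 1" z p q] degree_solid[of l "m + 1" z p q]
  have nz: "(of_nat l + 1 :: complex) \<noteq> 0"
    by (rule of_nat_add_1_neq_0)
  have "(of_nat l + 1) * (of_int m * solid (Suc l) m z p q) =
     (of_nat l + 1) * (- p / 2 * solid l (m - 1) z p q - q / 2 * solid l (m + 1) z p q)"
    using I D solid_Suc'[of l m z p q] unfolding of_int_add of_int_diff of_int_1
    apply (simp del: solid.simps)
    by algebra
  then show ?case using nz by (simp del: solid.simps)
qed

lemma raise_solid:
  "(of_nat l + of_int m) * solid l m z p q = z * lower l m z p q - p * lower l (m - 1) z p q"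
  "(of_nat l - of_int m) * solid l m z p q = z * lower l m z p q + q * lower l (m + 1) z p q"
  using degree_solid[of l m z p q] order_solid[of m l z p q] by algebra+

text \<open>These identities say that the Kelvin transform \<open>R_l^m / \<rho>\<^sup>2\<^sup>l\<^sup>+\<^sup>1\<close>, where
\<open>\<rho>\<^sup>2 = z\<^sup>2 + p q\<close>, has partial derivatives that are again Kelvin transforms, of degree one more:
the right-hand sides are, up to sign, the numerators that the quotient rule produces. They follow by eliminating
between the first-order recurrences of \<open>raise_solid\<close> in degrees \<open>l\<close> and \<open>l + 1\<close>.\<close>

lemma kelvin_solid:
  "((of_nat l + 1)\<^sup>2 - (of_int m)\<^sup>2) * solid (Suc l) m z p q =
     (2 * of_nat l + 1) * z * solid l m z p q - (z\<^sup>2 + p * q) * lower l m z p q"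
  "(of_nat l + of_int m + 2) * (of_nat l + of_int m + 1) * solid (Suc l) (m + 1) z p q =
     - (2 * of_nat l + 1) * p * solid l m z p q + (z\<^sup>2 + p * q) * lower l (m + 1) z p q"
  "(of_nat l - of_int m + 2) * (of_nat l - of_int m + 1) * solid (Suc l) (m - 1) z p q =
     (2 * of_nat l + 1) * q * solid l m z p q + (z\<^sup>2 + p * q) * lower l (m - 1) z p q"
proof -
  have a: "(of_nat l + 1 + of_int n) * solid (Suc l) n z p q = z * solid l n z p q - p * solid l (n - 1) z p q"
       "(of_nat l + 1 - of_int n) * solid (Suc l) n z p q = z * solid l n z p q + q * solid l (n + 1) z p q"
    for n using raise_solid[of "Suc l" n z p q] by (simp_all add: add.commute del: solid.simps)
  note r = raise_solid[of l _ z p q]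
  show "((of_nat l + 1)\<^sup>2 - (of_int m)\<^sup>2) * solid (Suc l) m z p q =
     (2 * of_nat l + 1) * z * solid l m z p q - (z\<^sup>2 + p * q) * lower l m z p q"
    using a[of m] r[of m] r[of "m - 1"] r[of "m + 1"] 
    by (simp del: solid.simps) algebra
  show  "(of_nat l + of_int m + 2) * (of_nat l + of_int m + 1) * solid (Suc l) (m + 1) z p q =
     - (2 * of_nat l + 1) * p * solid l m z p q + (z\<^sup>2 + p * q) * lower l (m + 1) z p q"
    using a[of "m + 1"] r[of m] r[of "m + 1"]
    by (simp del: solid.simps) algebra
  show "(of_nat l - of_int m + 2) * (of_nat l - of_int m + 1) * solid (Suc l) (m - 1) z p q =
     (2 * of_nat l + 1) * q * solid l m z p q + (z\<^sup>2 + p * q) * lower l (m - 1) z p q"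
    using a[of "m - 1"] r[of m] r[of "m - 1"]
    by (simp del: solid.simps) algebra
qed

lemma solid_eq_0: "\<bar>m\<bar> > int l \<Longrightarrow> solid l m z p q = 0"
  by (induction l arbitrary: m) auto

lemma solid_scale: "solid l m (c * z) (c * p) (c * q) = c ^ l * solid l m z p q"
  by (induction l arbitrary: m) (simp_all add: field_simps)

lemma cnj_solid: "cnj (solid l m z p q) = (-1) powi m * solid l (- m) (cnj z) (cnj q) (cnj p)"
  by (induction l arbitrary: m)
     (simp_all add: power_int_add power_int_diff field_simps)

text \<open>Each partial derivative lowers the degree, without a constant depending on \<open>l\<close> or \<open>m\<close>. It is
stated along arbitrary differentiable curves or maps into the coordinates because it is used both for real
gradients and for a complex parameter.\<close>

lemma has_derivative_solid:
  fixes Z P Q :: "'a::real_normed_vector \<Rightarrow> complex"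
  assumes "(Z has_derivative Z') (at x within X)" "(P has_derivative P') (at x within X)"
    "(Q has_derivative Q') (at x within X)"
  shows "((\<lambda>x. solid l m (Z x) (P x) (Q x)) has_derivative
     (\<lambda>h. Z' h * lower l m (Z x) (P x) (Q x) + Q' h / 2 * lower l (m + 1) (Z x) (P x) (Q x)
        - P' h / 2 * lower l (m - 1) (Z x) (P x) (Q x))) (at x within X)"
proof (induction l arbitrary: m)
  case 0
  then show ?case by simp
next
  case (Suc l)
  have nz: "(of_nat l + 1 :: complex) \<noteq> 0"
    by (rule of_nat_add_1_neq_0)
  define c where "c = inverse (of_nat l + 1 :: complex)"
  have c: "c * (of_nat l + 1) = 1" using nz by (simp add: c_def)
  define p where "p = (\<lambda>x. P x / 2)"
  define q where "q = (\<lambda>x. Q x / 2)"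
  define dp where "dp = (\<lambda>h. P' h / 2)"
  define dq where "dq = (\<lambda>h. Q' h / 2)"
  have dP: "(p has_derivative dp) (at x within X)" and dQ: "(q has_derivative dq) (at x within X)"
    unfolding p_def q_def dp_def dq_def
    by (rule bounded_linear.has_derivative[OF bounded_linear_divide assms(2)]
             bounded_linear.has_derivative[OF bounded_linear_divide assms(3)])+
  let ?R = "\<lambda>k x. solid l k (Z x) (P x) (Q x)" and ?L = "\<lambda>k. lower l k (Z x) (P x) (Q x)"
  have R': "(?R k has_derivative (\<lambda>h. Z' h * ?L k + dq h * ?L (k + 1) - dp h * ?L (k - 1)))
      (at x within X)" for k
    unfolding dp_def dq_def by (rule Suc.IH)
  have E: "?R k x + Z x * ?L k - p x * ?L (k - 1) + q x * ?L (k + 1) = (of_nat l + 1) * ?R k x" for k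
    using degree_solid[of l k "Z x" "P x" "Q x"] by (simp add: distrib_right p_def q_def)
  \<comment> \<open>Sorting the product rule by the differentials turns each coefficient into the right-hand side of
    Euler's identity plus one more copy of the harmonic, that is, \<open>l + 1\<close> copies.\<close>
  have regroup: "c * (z * (dz * L0 + b * Lp - a * Lm) + dz * R0 - (u * (dz * Lm + b * L0 - a * Lmm) + a * Rm)
        + (v * (dz * Lp + b * Lpp - a * L0) + b * Rp))
      = c * (dz * (R0 + z * L0 - u * Lm + v * Lp) + b * (Rp + z * Lp - u * L0 + v * Lpp)
         - a * (Rm + z * Lm - u * Lmm + v * L0))"
    for z dz a b u v L0 Lp Lm Lpp Lmm R0 Rp Rm :: complex
    by (simp add: algebra_simps)
  have pull: "c * (dz * (n * R0) + b * (n * Rp) - a * (n * Rm)) = c * n * (dz * R0 + b * Rp - a * Rm)"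
    for dz a b n R0 Rp Rm :: complex
    by (simp add: algebra_simps)
  have *: "c * (Z x * (Z' h * ?L m + dq h * ?L (m + 1) - dp h * ?L (m - 1)) + Z' h * ?R m x
        - (p x * (Z' h * ?L (m - 1) + dq h * ?L (m - 1 + 1) - dp h * ?L (m - 1 - 1)) + dp h * ?R (m - 1) x)
        + (q x * (Z' h * ?L (m + 1) + dq h * ?L (m + 1 + 1) - dp h * ?L (m + 1 - 1)) + dq h * ?R (m + 1) x))
     = Z' h * ?R m x + dq h * ?R (m + 1) x - dp h * ?R (m - 1) x" for h
    using E[of m] E[of "m + 1"] E[of "m - 1"]
    by (simp only: add_diff_cancel_right' diff_add_cancel regroup pull c mult_1)
  have "((\<lambda>x. c * (Z x * ?R m x - p x * ?R (m - 1) x + q x * ?R (m + 1) x)) has_derivative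
     (\<lambda>h. Z' h * ?R m x + dq h * ?R (m + 1) x - dp h * ?R (m - 1) x)) (at x within X)"
    by (rule has_derivative_eq_rhs[OF has_derivative_mult_right[OF has_derivative_add[OF has_derivative_diff[OF
          has_derivative_mult[OF assms(1) R'[of m]] has_derivative_mult[OF dP R'[of "m - 1"]]]
          has_derivative_mult[OF dQ R'[of "m + 1"]]]]])
       (rule ext, rule *)
  moreover have "solid (Suc l) m (Z x) (P x) (Q x) = c * (Z x * ?R m x - p x * ?R (m - 1) x + q x * ?R (m + 1) x)" for x
    unfolding solid.simps c_def p_def q_def divide_inverse by (rule mult.commute)
  ultimately show ?case by (simp only: lower_Suc dp_def dq_def)
qed

section \<open>Irregular solid harmonics\<close>

text \<open>
  The Kelvin transform of \<^term>\<open>solid\<close>, where \<open>s\<close> stands for \<open>1 / \<rho>\<close>. It is a separate argument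
  because over the complex numbers a branch of the square root has to be chosen. The factorials make the
  ladder relations free of constants.
\<close>

definition solid_irreg :: "nat \<Rightarrow> int \<Rightarrow> complex \<Rightarrow> complex \<Rightarrow> complex \<Rightarrow> complex \<Rightarrow> complex" where
  "solid_irreg l m z p q s =
     fact (nat (int l - m)) * fact (nat (int l + m)) * solid l m z p q * s ^ (2 * l + 1)"

lemma solid_irreg_scale:
  assumes "c \<noteq> 0"
  shows "solid_irreg l m (c * z) (c * p) (c * q) (s / c) = solid_irreg l m z p q s / c ^ (l + 1)"
proof -
  have "c ^ l / c ^ (2 * l + 1) = 1 / c ^ (l + 1)"
    using assms by (simp add: field_simps power_add[symmetric] mult_2 mult_2_right)
  then have "c ^ l * (s / c) ^ (2 * l + 1) = s ^ (2 * l + 1) / c ^ (l + 1)"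
    by (metis (no_types, lifting) mult.commute mult_1 power_divide times_divide_eq_left times_divide_eq_right)
  then have "A * (c ^ l * B) * (s / c) ^ (2 * l + 1) = A * B * s ^ (2 * l + 1) / c ^ (l + 1)" for A B
    by (metis (no_types, lifting) mult.assoc mult.left_commute times_divide_eq_right)
  then show ?thesis by (simp add: solid_irreg_def solid_scale)
qed

text \<open>The hypotheses on \<open>S\<close> say that it is a branch of \<open>(Z\<^sup>2 + P Q)\<^sup>-\<^sup>1\<^sup>/\<^sup>2\<close>. After the quotient
rule the three coefficients are those of \<open>kelvin_solid\<close>, whose integer factors are absorbed by the
factorials.\<close>

lemma has_derivative_solid_irreg:
  fixes Z P Q S :: "'a::real_normed_vector \<Rightarrow> complex"
  assumes D: "(Z has_derivative Z') (at x within X)" "(P has_derivative P') (at x within X)"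
    "(Q has_derivative Q') (at x within X)"
    and S: "(S has_derivative
       (\<lambda>h. - (2 * Z x * Z' h + P' h * Q x + P x * Q' h) / 2 * S x ^ 3)) (at x within X)"
    and SQ: "(S x)\<^sup>2 * ((Z x)\<^sup>2 + P x * Q x) = 1"
    and m: "\<bar>m\<bar> \<le> int l"
  shows "((\<lambda>x. solid_irreg l m (Z x) (P x) (Q x) (S x)) has_derivative
     (\<lambda>h. - Z' h * solid_irreg (Suc l) m (Z x) (P x) (Q x) (S x)
        + Q' h / 2 * solid_irreg (Suc l) (m + 1) (Z x) (P x) (Q x) (S x)
        - P' h / 2 * solid_irreg (Suc l) (m - 1) (Z x) (P x) (Q x) (S x))) (at x within X)"
proof -
  define F :: complex where "F = fact (nat (int l - m)) * fact (nat (int l + m))"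
  define n where "n = nat (int l - m)"
  define k where "k = nat (int l + m)"
  have nk: "of_nat n = (of_nat l - of_int m :: complex)" "of_nat k = (of_nat l + of_int m :: complex)"
    using m unfolding n_def k_def by (simp_all add: of_nat_nat)
  have nats: "nat (int (Suc l) - m) = Suc n" "nat (int (Suc l) + m) = Suc k"
    "nat (int (Suc l) - (m + 1)) = n" "nat (int (Suc l) + (m + 1)) = Suc (Suc k)"
    "nat (int (Suc l) - (m - 1)) = Suc (Suc n)" "nat (int (Suc l) + (m - 1)) = k"
    using m unfolding n_def k_def by auto
  have F: "fact n * fact k = F" by (simp add: F_def n_def k_def)
  define s where "s = S x"
  define z where "z = Z x"
  define p where "p = P x"
  define q where "q = Q x"
  have pw: "s ^ (2 * Suc l + 1) = s ^ (2 * l) * s ^ 3" "s ^ (2 * l + 1) = s ^ (2 * l) * s"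
    by (simp_all add: power_add power3_eq_cube mult_ac)
  have sq: "s\<^sup>2 * (z\<^sup>2 + p * q) = 1" using SQ by (simp add: s_def z_def p_def q_def)
  note K = kelvin_solid[of l m z p q]
  have Suc_irreg:
    "solid_irreg (Suc l) m z p q s = F * s ^ (2 * l) * s ^ 3 *
       ((2 * of_nat l + 1) * z * solid l m z p q - (z\<^sup>2 + p * q) * lower l m z p q)"
    "solid_irreg (Suc l) (m + 1) z p q s = F * s ^ (2 * l) * s ^ 3 *
       (- (2 * of_nat l + 1) * p * solid l m z p q + (z\<^sup>2 + p * q) * lower l (m + 1) z p q)"
    "solid_irreg (Suc l) (m - 1) z p q s = F * s ^ (2 * l) * s ^ 3 *
       ((2 * of_nat l + 1) * q * solid l m z p q + (z\<^sup>2 + p * q) * lower l (m - 1) z p q)"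
    unfolding K[symmetric] solid_irreg_def nats
    unfolding pw F[symmetric] fact_Suc of_nat_Suc nk
    by (simp_all del: solid.simps add: power2_eq_square algebra_simps)
  \<comment> \<open>The term that differentiates the regular harmonic has two factors \<open>s\<close> less than the one that
    differentiates \<open>s\<^sup>2\<^sup>l\<^sup>+\<^sup>1\<close>; multiplying it by \<open>s\<^sup>2 (z\<^sup>2 + p q) = 1\<close> aligns them.\<close>
  have step: "F * (solid l m z p q * (of_nat (2 * l + 1) * (- (2 * z * dz + dp * q + p * dq) / 2 * s ^ 3) * s ^ (2 * l))
      + (dz * lower l m z p q + dq / 2 * lower l (m + 1) z p q - dp / 2 * lower l (m - 1) z p q) * (s ^ (2 * l) * s))
    = - dz * solid_irreg (Suc l) m z p q s + dq / 2 * solid_irreg (Suc l) (m + 1) z p q s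
        - dp / 2 * solid_irreg (Suc l) (m - 1) z p q s" for dz dp dq
  proof -
    have s: "s = s ^ 3 * (z\<^sup>2 + p * q)"
      using sq by (metis mult.assoc mult.commute mult_1 power2_eq_square power3_eq_cube)
    define T where "T = s ^ 3"
    define U where "U = z\<^sup>2 + p * q"
    have sU: "s = T * U" using s by (simp add: T_def U_def)
    have "F * (A * (b * (- (2 * z * dz + dp * q + p * dq) / 2 * T) * V) + (dz * L0 + dq / 2 * Lp - dp / 2 * Lm) * (V * (T * U)))
       = - dz * (F * V * T * (b * z * A - U * L0)) + dq / 2 * (F * V * T * (- b * p * A + U * Lp))
         - dp / 2 * (F * V * T * (b * q * A + U * Lm))" for A b V L0 Lp Lm
      by (simp add: algebra_simps add_divide_distrib diff_divide_distrib)
    from this[of "solid l m z p q" "2 * of_nat l + 1" "s ^ (2 * l)" "lower l m z p q" "lower l (m + 1) z p q" "lower l (m - 1) z p q"]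
    show ?thesis
      unfolding Suc_irreg T_def[symmetric] U_def[symmetric] sU[symmetric] by (simp add: add.commute[of 1])
  qed
  have "((\<lambda>x. F * (solid l m (Z x) (P x) (Q x) * S x ^ (2 * l + 1))) has_derivative
     (\<lambda>h. - Z' h * solid_irreg (Suc l) m z p q s
        + Q' h / 2 * solid_irreg (Suc l) (m + 1) z p q s
        - P' h / 2 * solid_irreg (Suc l) (m - 1) z p q s)) (at x within X)"
    by (rule has_derivative_eq_rhs[OF has_derivative_mult_right[OF has_derivative_mult[OF
          has_derivative_solid[OF D] has_derivative_power[OF S]]]])
       (simp only: step[symmetric] z_def[symmetric] p_def[symmetric] q_def[symmetric]
          s_def[symmetric] pw diff_add_inverse2)
  moreover have "solid_irreg l m z p q s = F * (solid l m z p q * s ^ (2 * l + 1))" for z p q s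
    by (simp add: solid_irreg_def F_def mult.assoc)
  ultimately show ?thesis
    by (simp only: z_def p_def q_def s_def)
qed

section \<open>The ladder relations inside a translation sum\<close>

declare solid.simps(2) [simp del]

lemma sum_shift_supported:
  fixes f :: "int \<Rightarrow> 'a::comm_monoid_add"
  assumes "\<And>k. \<bar>k\<bar> > int n \<Longrightarrow> f k = 0" and "\<bar>d\<bar> \<le> 1"
  shows "(\<Sum>\<mu> = - int n..int n. f \<mu>) = (\<Sum>\<mu> = - int (Suc n)..int (Suc n). f (\<mu> + d))"
proof -
  have "(\<Sum>\<mu> = - int (Suc n)..int (Suc n). f (\<mu> + d)) = sum f {- int (Suc n) + d..int (Suc n) + d}"
    by (rule sum.reindex_bij_witness[of _ "\<lambda>k. k - d" "\<lambda>k. k + d"]) auto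
  also have "\<dots> = sum f {- int n..int n}"
    using assms by (intro sum.mono_neutral_right) auto
  finally show ?thesis ..
qed

text \<open>Summation by parts: the three shifts that differentiation performs on the irregular factor \<open>G\<close> are moved
to the regular factor, which vanishes outside the summation range. The alternating signs make all three
terms match. With \<open>(dz, dp, dq)\<close> equal to \<open>(z, p, q)\<close> the right-hand side is \<open>n + 1\<close> times the
translation sum of degree \<open>n + 1\<close>, by the defining recurrence of \<^term>\<open>solid\<close>; with a fixed
direction it contains the derivative of the regular harmonics of degree \<open>n + 1\<close> in that direction.\<close>

lemma ladder_sum:
  "(\<Sum>\<mu> = - int n..int n. (-1) powi (int n + \<mu>) * solid n \<mu> z p q *
       (- dz * G \<mu> + dq / 2 * G (\<mu> - 1) - dp / 2 * G (\<mu> + 1))) =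
   (\<Sum>\<mu> = - int (Suc n)..int (Suc n). (-1) powi (int (Suc n) + \<mu>) *
       (dz * solid n \<mu> z p q + dq / 2 * solid n (\<mu> + 1) z p q - dp / 2 * solid n (\<mu> - 1) z p q) * G \<mu>)"
proof -
  define f where "f = (\<lambda>d \<mu>. (-1) powi (int n + \<mu>) * solid n \<mu> z p q * G (\<mu> - d))"
  have sh: "(\<Sum>\<mu> = - int n..int n. f d \<mu>) = (\<Sum>\<mu> = - int (Suc n)..int (Suc n). f d (\<mu> + d))"
    if "\<bar>d\<bar> \<le> 1" for d
    using that by (intro sum_shift_supported) (simp_all add: f_def solid_eq_0)
  have "(\<Sum>\<mu> = - int n..int n. (-1) powi (int n + \<mu>) * solid n \<mu> z p q *
       (- dz * G \<mu> + dq / 2 * G (\<mu> - 1) - dp / 2 * G (\<mu> + 1))) =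
     - dz * (\<Sum>\<mu> = - int n..int n. f 0 \<mu>) + dq / 2 * (\<Sum>\<mu> = - int n..int n. f 1 \<mu>)
     - dp / 2 * (\<Sum>\<mu> = - int n..int n. f (-1) \<mu>)"
    unfolding sum_distrib_left sum_subtractf[symmetric] sum.distrib[symmetric]
    by (intro sum.cong refl) (simp add: f_def algebra_simps)
  also have "\<dots> = - dz * (\<Sum>\<mu> = - int (Suc n)..int (Suc n). f 0 (\<mu> + 0))
     + dq / 2 * (\<Sum>\<mu> = - int (Suc n)..int (Suc n). f 1 (\<mu> + 1))
     - dp / 2 * (\<Sum>\<mu> = - int (Suc n)..int (Suc n). f (-1) (\<mu> + - 1))"
    using sh[of 0] sh[of 1] sh[of "-1"] by simp
  also have "\<dots> = (\<Sum>\<mu> = - int (Suc n)..int (Suc n). (-1) powi (int (Suc n) + \<mu>) *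
       (dz * solid n \<mu> z p q + dq / 2 * solid n (\<mu> + 1) z p q - dp / 2 * solid n (\<mu> - 1) z p q) * G \<mu>)"
    unfolding sum_distrib_left sum_subtractf[symmetric] sum.distrib[symmetric]
    by (intro sum.cong refl)
       (simp add: f_def power_int_add power_int_diff algebra_simps add_divide_distrib diff_divide_distrib)
  finally show ?thesis .
qed

text \<open>Differentiating the \<open>n\<close>-th translation sum in the direction of \<open>r\<close> gives \<open>n + 1\<close> times the next
one; by induction the sums are the Taylor coefficients along the ray.\<close>

lemma translation_derivative:
  fixes J :: "nat \<Rightarrow> int \<Rightarrow> complex \<Rightarrow> complex"
  assumes J: "\<And>L M. \<bar>M\<bar> \<le> int L \<Longrightarrow> (J L M has_field_derivative
     - rz * J (Suc L) M t + rq / 2 * J (Suc L) (M + 1) t - rp / 2 * J (Suc L) (M - 1) t) (at t)"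
    and m: "\<bar>m\<bar> \<le> int l"
  shows "((\<lambda>t. \<Sum>\<mu> = - int n..int n. (-1) powi (int n + \<mu>) * solid n \<mu> rz rp rq * J (l + n) (m - \<mu>) t)
     has_field_derivative
     (of_nat n + 1) * (\<Sum>\<mu> = - int (Suc n)..int (Suc n).
        (-1) powi (int (Suc n) + \<mu>) * solid (Suc n) \<mu> rz rp rq * J (l + Suc n) (m - \<mu>) t)) (at t)"
proof -
  let ?G = "\<lambda>\<mu>. J (l + Suc n) (m - \<mu>) t"
  have "((\<lambda>t. \<Sum>\<mu> = - int n..int n. (-1) powi (int n + \<mu>) * solid n \<mu> rz rp rq * J (l + n) (m - \<mu>) t)
     has_field_derivative
     (\<Sum>\<mu> = - int n..int n. (-1) powi (int n + \<mu>) * solid n \<mu> rz rp rq *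
       (- rz * ?G \<mu> + rq / 2 * ?G (\<mu> - 1) - rp / 2 * ?G (\<mu> + 1)))) (at t)"
  proof (rule DERIV_sum[where f' = "\<lambda>\<mu>. (-1) powi (int n + \<mu>) * solid n \<mu> rz rp rq *
       (- rz * ?G \<mu> + rq / 2 * ?G (\<mu> - 1) - rp / 2 * ?G (\<mu> + 1))"], rule DERIV_cmult)
    fix \<mu> assume "\<mu> \<in> {- int n..int n}"
    then have "\<bar>m - \<mu>\<bar> \<le> int (l + n)" using m by auto
    then show "(J (l + n) (m - \<mu>) has_field_derivative
         - rz * ?G \<mu> + rq / 2 * ?G (\<mu> - 1) - rp / 2 * ?G (\<mu> + 1)) (at t)"
      using J[of "m - \<mu>" "l + n"] by (simp add: algebra_simps)
  qed
  also have "(\<Sum>\<mu> = - int n..int n. (-1) powi (int n + \<mu>) * solid n \<mu> rz rp rq *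
       (- rz * ?G \<mu> + rq / 2 * ?G (\<mu> - 1) - rp / 2 * ?G (\<mu> + 1))) =
     (of_nat n + 1) * (\<Sum>\<mu> = - int (Suc n)..int (Suc n).
        (-1) powi (int (Suc n) + \<mu>) * solid (Suc n) \<mu> rz rp rq * ?G \<mu>)"
    unfolding ladder_sum[where G = ?G] sum_distrib_left
  proof (rule sum.cong[OF refl])
    fix \<mu> assume "\<mu> \<in> {- int (Suc n)..int (Suc n)}"
    have "rz * solid n \<mu> rz rp rq + rq / 2 * solid n (\<mu> + 1) rz rp rq - rp / 2 * solid n (\<mu> - 1) rz rp rq
      = (of_nat n + 1) * solid (Suc n) \<mu> rz rp rq"
      unfolding solid_Suc' by simp
    then show "(-1) powi (int (Suc n) + \<mu>) * (rz * solid n \<mu> rz rp rq + rq / 2 * solid n (\<mu> + 1) rz rp rq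
        - rp / 2 * solid n (\<mu> - 1) rz rp rq) * ?G \<mu> =
      (of_nat n + 1) * ((-1) powi (int (Suc n) + \<mu>) * solid (Suc n) \<mu> rz rp rq * ?G \<mu>)"
      by (simp only:) (simp add: mult_ac)
  qed
  finally show ?thesis .
qed

section \<open>The translation formula\<close>

definition planar :: "real ^ 3 \<Rightarrow> complex" where
  "planar x = Complex (x $ 1) (x $ 2)"

definition axial :: "real ^ 3 \<Rightarrow> complex" where
  "axial x = of_real (x $ 3)"

lemma norm_vec3: "(norm (x :: real ^ 3))\<^sup>2 = (x $ 1)\<^sup>2 + (x $ 2)\<^sup>2 + (x $ 3)\<^sup>2"
  unfolding power2_norm_eq_inner inner_vec_def by (simp add: sum_3 power2_eq_square)

lemma inner_vec3: "(x :: real ^ 3) \<bullet> y = x $ 1 * y $ 1 + x $ 2 * y $ 2 + x $ 3 * y $ 3"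
  unfolding inner_vec_def by (simp add: sum_3)

lemma coord_simps:
  "planar (x + y) = planar x + planar y" "axial (x + y) = axial x + axial y"
  "planar (c *\<^sub>R x) = of_real c * planar x" "axial (c *\<^sub>R x) = of_real c * axial x"
  by (simp_all add: planar_def axial_def complex_eq_iff)

lemma norm_coords: "(axial x)\<^sup>2 + planar x * cnj (planar x) = of_real ((norm x)\<^sup>2)"
  using norm_vec3[of x] by (simp add: axial_def planar_def complex_eq_iff power2_eq_square)

text \<open>An analytic continuation of \<open>1 / |a + t r|\<close> to complex \<open>t\<close>. One has
\<open>|a + t r|\<^sup>2 = |a|\<^sup>2 (1 - t w) (1 - t w')\<close> with \<open>w, w'\<close> complex conjugate of modulus \<open>|r| / |a|\<close>;
as long as \<open>|t| < |a| / |r|\<close> both factors have positive real part, and the principal square root is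
holomorphic there. At \<open>t = 1\<close> the two roots are conjugate, so their product is positive, which
selects the correct sign.\<close>

lemma radial_branch:
  fixes r a :: "real ^ 3"
  assumes "norm r < norm a" "r \<noteq> 0"
  obtains S where
    "\<And>t. t \<in> ball 0 (norm a / norm r) \<Longrightarrow>
       (S t)\<^sup>2 * ((axial a + t * axial r)\<^sup>2 + (planar a + t * planar r) * (cnj (planar a) + t * cnj (planar r))) = 1"
    "\<And>t. t \<in> ball 0 (norm a / norm r) \<Longrightarrow>
       (S has_field_derivative - (2 * (axial a + t * axial r) * axial r + planar r * (cnj (planar a) + t * cnj (planar r))
          + (planar a + t * planar r) * cnj (planar r)) / 2 * S t ^ 3) (at t)"
    "S 0 = of_real (inverse (norm a))" "S 1 = of_real (inverse (norm (r + a)))"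
proof -
  have a0: "norm a > 0" and r0: "norm r > 0" using assms by auto
  define A :: complex where "A = of_real (norm a)"
  have A0: "A \<noteq> 0" using a0 by (simp add: A_def)
  \<comment> \<open>The discriminant of \<open>|a + t r|\<^sup>2\<close> as a quadratic in \<open>t\<close> is \<open>- 4 d\<close>.\<close>
  define d where "d = (norm a)\<^sup>2 * (norm r)\<^sup>2 - (a \<bullet> r)\<^sup>2"
  have d0: "d \<ge> 0"
    using Cauchy_Schwarz_ineq[of a r] by (simp add: d_def power2_norm_eq_inner)
  define w where "w = Complex (- (a \<bullet> r)) (sqrt d) / A\<^sup>2"
  have cw: "cnj w = Complex (- (a \<bullet> r)) (- sqrt d) / A\<^sup>2"
    by (simp add: w_def A_def complex_cnj_divide complex_eq_iff del: complex_cnj_divide)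
  have wsum: "A\<^sup>2 * (w + cnj w) = - 2 * of_real (a \<bullet> r)"
    unfolding cw unfolding w_def using A0 by (simp add: distrib_left) (simp add: complex_eq_iff)
  have wprod0: "A\<^sup>2 * A\<^sup>2 * (w * cnj w) = of_real ((norm a)\<^sup>2 * (norm r)\<^sup>2)"
    unfolding cw unfolding w_def using A0 d0
    by (simp add: field_simps) (simp add: complex_eq_iff d_def power2_eq_square)
  then have "A\<^sup>2 * (A\<^sup>2 * (w * cnj w)) = A\<^sup>2 * of_real ((norm r)\<^sup>2)"
    by (simp only: A_def mult.assoc of_real_mult of_real_power)
  then have wprod: "A\<^sup>2 * (w * cnj w) = of_real ((norm r)\<^sup>2)"
    using A0 by (metis mult_left_cancel power_not_zero)
  have "of_real ((norm a * cmod w)\<^sup>2) = (of_real ((norm r)\<^sup>2) :: complex)"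
    using wprod complex_norm_square[of w] by (simp add: A_def power_mult_distrib)
  then have "(norm a * cmod w)\<^sup>2 = (norm r)\<^sup>2"
    by (simp only: of_real_eq_iff)
  then have "norm a * cmod w = norm r"
    using a0 r0 by (simp add: power2_eq_iff_nonneg)
  then have wn: "cmod w = norm r / norm a" using a0 by (simp add: field_simps)
  have factor: "(axial a + t * axial r)\<^sup>2 + (planar a + t * planar r) * (cnj (planar a) + t * cnj (planar r))
     = A\<^sup>2 * ((1 - t * w) * (1 - t * cnj w))" for t
  proof -
    have "(axial a + t * axial r)\<^sup>2 + (planar a + t * planar r) * (cnj (planar a) + t * cnj (planar r))
      = ((axial a)\<^sup>2 + planar a * cnj (planar a)) + t * (2 * axial a * axial r + planar a * cnj (planar r) + planar r * cnj (planar a))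
        + t\<^sup>2 * ((axial r)\<^sup>2 + planar r * cnj (planar r))"
      by (simp add: power2_eq_square algebra_simps)
    also have "2 * axial a * axial r + planar a * cnj (planar r) + planar r * cnj (planar a) = 2 * of_real (a \<bullet> r)"
      by (simp add: axial_def planar_def inner_vec3 complex_eq_iff)
    also have "\<dots> = - (A\<^sup>2 * (w + cnj w))" using wsum by simp
    also have "(axial a)\<^sup>2 + planar a * cnj (planar a) = A\<^sup>2" by (simp add: norm_coords A_def)
    also have "(axial r)\<^sup>2 + planar r * cnj (planar r) = A\<^sup>2 * (w * cnj w)" by (simp add: norm_coords wprod)
    finally show ?thesis by (simp add: power2_eq_square algebra_simps)
  qed
  define u v where "u = (\<lambda>t. csqrt (1 - t * w))" and "v = (\<lambda>t. csqrt (1 - t * cnj w))"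
  define S where "S = (\<lambda>t. inverse (A * u t * v t))"
  have pos: "Re (1 - t * w) > 0" "Re (1 - t * cnj w) > 0" if "t \<in> ball 0 (norm a / norm r)" for t
  proof -
    have "cmod t * norm r < norm a" using that r0 by (simp add: pos_less_divide_eq)
    then have "cmod t * cmod w < 1" using a0 unfolding wn by (simp add: pos_divide_less_eq)
    then have "cmod (t * w) < 1" "cmod (t * cnj w) < 1" by (simp_all add: norm_mult)
    then show "Re (1 - t * w) > 0" "Re (1 - t * cnj w) > 0"
      using complex_Re_le_cmod[of "t * w"] complex_Re_le_cmod[of "t * cnj w"] by simp_all
  qed
  have nn: "1 - t * w \<notin> \<real>\<^sub>\<le>\<^sub>0" "1 - t * cnj w \<notin> \<real>\<^sub>\<le>\<^sub>0" if "t \<in> ball 0 (norm a / norm r)" for t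
    using pos[OF that] by (auto simp: complex_nonpos_Reals_iff)
  have nz: "u t \<noteq> 0" "v t \<noteq> 0" if "t \<in> ball 0 (norm a / norm r)" for t
    unfolding u_def v_def csqrt_eq_0 using pos[OF that] by (metis less_irrefl zero_complex.sel(1))+
  have uv2: "(u t)\<^sup>2 = 1 - t * w" "(v t)\<^sup>2 = 1 - t * cnj w" for t
    by (simp_all add: u_def v_def)
  have SQ: "(S t)\<^sup>2 * ((axial a + t * axial r)\<^sup>2 + (planar a + t * planar r) * (cnj (planar a) + t * cnj (planar r))) = 1"
    if "t \<in> ball 0 (norm a / norm r)" for t
    unfolding factor uv2[symmetric] S_def using nz[OF that] A0 by (simp add: field_simps)
  have S': "(S has_field_derivative - (2 * (axial a + t * axial r) * axial r + planar r * (cnj (planar a) + t * cnj (planar r))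
          + (planar a + t * planar r) * cnj (planar r)) / 2 * S t ^ 3) (at t)"
    if t: "t \<in> ball 0 (norm a / norm r)" for t
  proof -
    have du: "(u has_field_derivative - w / (2 * u t)) (at t)"
      unfolding u_def by (rule derivative_eq_intros refl nn[OF t])+ (simp add: field_simps)
    have dv: "(v has_field_derivative - cnj w / (2 * v t)) (at t)"
      unfolding v_def by (rule derivative_eq_intros refl nn[OF t])+ (simp add: field_simps)
    have "(S has_field_derivative - (inverse (A * u t * v t) * (A * (- w / (2 * u t)) * v t
            + - cnj w / (2 * v t) * (A * u t)) * inverse (A * u t * v t))) (at t)"
      unfolding S_def using nz[OF t] A0
      by (intro DERIV_inverse'[OF DERIV_mult[OF DERIV_cmult[OF du] dv]]) simp
    also have "- (inverse (A * u t * v t) * (A * (- w / (2 * u t)) * v t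
            + - cnj w / (2 * v t) * (A * u t)) * inverse (A * u t * v t))
       = A\<^sup>2 * (w * (v t)\<^sup>2 + cnj w * (u t)\<^sup>2) / 2 * S t ^ 3"
      unfolding S_def using nz[OF t] A0 by (simp add: field_simps power2_eq_square power3_eq_cube)
    also have "A\<^sup>2 * (w * (v t)\<^sup>2 + cnj w * (u t)\<^sup>2) =
      - (2 * (axial a + t * axial r) * axial r + planar r * (cnj (planar a) + t * cnj (planar r))
          + (planar a + t * planar r) * cnj (planar r))"
    proof -
      have "2 * (axial a + t * axial r) * axial r + planar r * (cnj (planar a) + t * cnj (planar r)) + (planar a + t * planar r) * cnj (planar r)
        = (2 * axial a * axial r + planar a * cnj (planar r) + planar r * cnj (planar a)) + 2 * t * ((axial r)\<^sup>2 + planar r * cnj (planar r))"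
        by (simp add: power2_eq_square algebra_simps)
      also have "2 * axial a * axial r + planar a * cnj (planar r) + planar r * cnj (planar a) = 2 * of_real (a \<bullet> r)"
        by (simp add: axial_def planar_def inner_vec3 complex_eq_iff)
      also have "\<dots> = - (A\<^sup>2 * (w + cnj w))" using wsum by simp
      also have "(axial r)\<^sup>2 + planar r * cnj (planar r) = A\<^sup>2 * (w * cnj w)" by (simp add: norm_coords wprod)
      finally show ?thesis unfolding uv2 by (simp add: algebra_simps)
    qed
    finally show ?thesis .
  qed
  have one: "(1 :: complex) \<in> ball 0 (norm a / norm r)" using assms r0 by simp
  have S1: "S 1 = of_real (inverse (norm (r + a)))"
  proof -
    have "cnj (u 1) = v 1"
      unfolding u_def v_def using nn[OF one] by (subst cnj_csqrt) simp_all
    then have "S 1 = inverse (A * (u 1 * cnj (u 1)))" by (simp add: S_def mult.assoc)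
    also have "u 1 * cnj (u 1) = of_real ((cmod (u 1))\<^sup>2)"
      by (rule complex_norm_square[symmetric])
    finally have e: "S 1 = of_real (inverse (norm a * (cmod (u 1))\<^sup>2))" by (simp add: A_def)
    have "(S 1)\<^sup>2 * of_real ((norm (r + a))\<^sup>2) = 1"
      using SQ[OF one] norm_coords[of "r + a"] by (simp add: coord_simps add.commute)
    then have "of_real ((inverse (norm a * (cmod (u 1))\<^sup>2) * norm (r + a))\<^sup>2) = (1 :: complex)"
      unfolding e by (simp add: power_mult_distrib)
    then have "(inverse (norm a * (cmod (u 1))\<^sup>2) * norm (r + a))\<^sup>2 = 1"
      by (simp only: of_real_eq_1_iff)
    moreover have "inverse (norm a * (cmod (u 1))\<^sup>2) * norm (r + a) \<ge> 0" by simp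
    ultimately have "inverse (norm a * (cmod (u 1))\<^sup>2) * norm (r + a) = 1"
      by (metis abs_of_nonneg power2_eq_1_iff abs_1 abs_minus_cancel)
    then have "inverse (norm a * (cmod (u 1))\<^sup>2) = inverse (norm (r + a))"
      by (metis inverse_inverse_eq inverse_unique mult.commute)
    then show ?thesis using e by simp
  qed
  have S0: "S 0 = of_real (inverse (norm a))"
    by (simp add: S_def u_def v_def A_def)
  show thesis using that[of S] SQ S' S0 S1 by blast
qed

definition regular :: "nat \<Rightarrow> int \<Rightarrow> real ^ 3 \<Rightarrow> complex" where
  "regular l m x = solid l m (axial x) (planar x) (cnj (planar x))"

definition irregular :: "nat \<Rightarrow> int \<Rightarrow> real ^ 3 \<Rightarrow> complex" where
  "irregular l m x = solid_irreg l m (axial x) (planar x) (cnj (planar x)) (of_real (inverse (norm x)))"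

text \<open>The function \<open>K 0\<close> is the irregular harmonic along the ray, continued to complex \<open>t\<close>; its value at
\<open>t = 1\<close> is the sum of its Taylor series at \<open>0\<close>.\<close>

theorem irregular_translation:
  fixes r a :: "real ^ 3"
  assumes ra: "norm r < norm a" and r: "r \<noteq> 0" and m: "\<bar>m\<bar> \<le> int l"
  shows "(\<lambda>n. \<Sum>\<mu> = - int n..int n. (-1) powi (int n + \<mu>) * regular n \<mu> r * irregular (l + n) (m - \<mu>) a)
           sums irregular l m (r + a)"
proof -
  define B where "B = ball (0 :: complex) (norm a / norm r)"
  obtain S where SQ: "\<And>t. t \<in> B \<Longrightarrow>
       (S t)\<^sup>2 * ((axial a + t * axial r)\<^sup>2 + (planar a + t * planar r) * (cnj (planar a) + t * cnj (planar r))) = 1"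
    and S': "\<And>t. t \<in> B \<Longrightarrow>
       (S has_field_derivative - (2 * (axial a + t * axial r) * axial r + planar r * (cnj (planar a) + t * cnj (planar r))
          + (planar a + t * planar r) * cnj (planar r)) / 2 * S t ^ 3) (at t)"
    and S01: "S 0 = of_real (inverse (norm a))" "S 1 = of_real (inverse (norm (r + a)))"
    using radial_branch[OF ra r] unfolding B_def by blast
  define J where "J = (\<lambda>L M t. solid_irreg L M (axial a + t * axial r) (planar a + t * planar r)
      (cnj (planar a) + t * cnj (planar r)) (S t))"
  have J': "(J L M has_field_derivative
     - axial r * J (Suc L) M t + cnj (planar r) / 2 * J (Suc L) (M + 1) t - planar r / 2 * J (Suc L) (M - 1) t) (at t)"
    if t: "t \<in> B" and M: "\<bar>M\<bar> \<le> int L" for L M t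
  proof -
    have lin: "((\<lambda>t. x + t * y) has_derivative (\<lambda>h. h * y)) (at t)" for x y :: complex
      by (auto intro!: derivative_eq_intros)
    have dS: "(S has_derivative (\<lambda>h. - (2 * (axial a + t * axial r) * (h * axial r) +
          h * planar r * (cnj (planar a) + t * cnj (planar r)) + (planar a + t * planar r) * (h * cnj (planar r))) / 2 * S t ^ 3)) (at t)"
      using S'[OF t] unfolding has_field_derivative_def
      by (rule has_derivative_eq_rhs) (simp add: fun_eq_iff algebra_simps add_divide_distrib)
    show ?thesis
      unfolding has_field_derivative_def J_def
      by (rule has_derivative_eq_rhs[OF has_derivative_solid_irreg[OF lin lin lin dS SQ[OF t] M]])
         (simp add: fun_eq_iff algebra_simps)
  qed
  define K where "K = (\<lambda>n t. \<Sum>\<mu> = - int n..int n. (-1) powi (int n + \<mu>) *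
      solid n \<mu> (axial r) (planar r) (cnj (planar r)) * J (l + n) (m - \<mu>) t)"
  have K': "(K n has_field_derivative (of_nat n + 1) * K (Suc n) t) (at t)" if "t \<in> B" for n t
    unfolding K_def by (rule translation_derivative[where J = J, OF J'[OF that] m])
  have opB: "open B" by (simp add: B_def)
  have deriv: "(deriv ^^ n) (K 0) t = fact n * K n t" if "t \<in> B" for n t
    using that
  proof (induction n arbitrary: t)
    case (Suc n)
    have "((deriv ^^ n) (K 0) has_field_derivative fact n * ((of_nat n + 1) * K (Suc n) t)) (at t)"
      by (rule has_field_derivative_transform_within_open[OF DERIV_cmult[OF K'[OF Suc.prems]] opB Suc.prems])
         (simp add: Suc.IH)
    then show ?case by (simp add: DERIV_imp_deriv algebra_simps)
  qed simp
  have "K 0 holomorphic_on B"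
    using K'[of _ 0] opB by (auto simp: holomorphic_on_open)
  moreover have "1 \<in> B" using ra r by (simp add: B_def)
  ultimately have "(\<lambda>n. (deriv ^^ n) (K 0) 0 / fact n * (1 - 0) ^ n) sums K 0 1"
    unfolding B_def by (rule holomorphic_power_series)
  moreover have "0 \<in> B" using ra r unfolding B_def
    by (metis centre_in_ball divide_pos_pos norm_ge_zero order_le_less_trans zero_less_norm_iff)
  ultimately have "(\<lambda>n. K n 0) sums K 0 1"
    by (simp add: deriv)
  moreover have "K 0 1 = irregular l m (r + a)"
    by (simp add: K_def J_def irregular_def S01 coord_simps add.commute)
  ultimately show ?thesis
    by (simp add: K_def J_def irregular_def regular_def S01)
qed

section \<open>Identification with the spherical harmonics\<close>

definition rodrigues :: "nat \<Rightarrow> real poly" where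
  "rodrigues l = smult (1 / (2 ^ l * fact l)) ([:-1, 0, 1:] ^ l)"

text \<open>All \<open>P_l^{(m)}\<close> are derivatives of the single polynomial \<open>(z\<^sup>2 - 1)\<^sup>l / (2\<^sup>l l!)\<close>, so
recurrences in \<open>l\<close> and \<open>m\<close> reduce to the Leibniz rule for a product with \<open>z\<close>.\<close>

lemma higher_pderiv_legendre: "(pderiv ^^ m) (legendre_poly l) = (pderiv ^^ (l + m)) (rodrigues l)"
  by (simp only: legendre_poly_def rodrigues_def higher_pderiv_smult add.commute[of l m] funpow_add o_apply)

lemma pderiv_rodrigues: "pderiv (rodrigues (Suc l)) = [:0, 1:] * rodrigues l"
proof -
  have "pderiv [:-1, 0, 1 :: real:] = [:0, 2:]" by (simp add: pderiv_pCons)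
  then have "pderiv (rodrigues (Suc l)) =
      smult (1 / (2 ^ Suc l * fact (Suc l)) * real (Suc l) * 2) ([:0, 1:] * [:-1, 0, 1:] ^ l)"
    by (simp add: rodrigues_def pderiv_smult pderiv_power_Suc mult_ac del: power_Suc fact_Suc of_nat_Suc)
  also have "1 / (2 ^ Suc l * fact (Suc l)) * real (Suc l) * 2 = 1 / (2 ^ l * fact l)"
    by (simp add: field_simps del: of_nat_Suc)
  finally show ?thesis by (simp add: rodrigues_def)
qed

lemma rodrigues_mult: "[:-1, 0, 1:] * rodrigues l = smult (2 * (real l + 1)) (rodrigues (Suc l))"
proof -
  have "1 / (2 ^ l * fact l) = 2 * (real l + 1) * (1 / (2 ^ Suc l * fact (Suc l)))"
    by (simp add: divide_simps)
  then show ?thesis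
    unfolding rodrigues_def by (simp only: mult_smult_right smult_smult power_Suc)
qed

lemma higher_pderiv_X_mult:
  "(pderiv ^^ Suc n) ([:0, 1:] * f) =
     [:0, 1:] * (pderiv ^^ Suc n) f + smult (of_nat (Suc n)) ((pderiv ^^ n) f)"
  for f :: "real poly"
proof (induction n)
  case 0
  then show ?case by (simp add: pderiv_mult pderiv_pCons)
next
  case (Suc n)
  have "(pderiv ^^ Suc (Suc n)) ([:0, 1:] * f) = pderiv ((pderiv ^^ Suc n) ([:0, 1:] * f))"
    by simp
  also have "\<dots> = pderiv ([:0, 1:] * (pderiv ^^ Suc n) f + smult (of_nat (Suc n)) ((pderiv ^^ n) f))"
    by (simp only: Suc.IH)
  also have "\<dots> = [:0, 1:] * (pderiv ^^ Suc (Suc n)) f + smult (of_nat (Suc (Suc n))) ((pderiv ^^ Suc n) f)"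
    by (simp add: pderiv_add pderiv_smult pderiv_mult pderiv_pCons smult_add_left numeral_poly)
  finally show ?case .
qed

lemma legendre_Suc:
  "poly ((pderiv ^^ Suc m) (legendre_poly (Suc l))) z =
     z * poly ((pderiv ^^ Suc m) (legendre_poly l)) z
     + (real l + real m + 1) * poly ((pderiv ^^ m) (legendre_poly l)) z"
proof -
  have "(pderiv ^^ (Suc l + Suc m)) (rodrigues (Suc l)) = (pderiv ^^ Suc (l + m)) (pderiv (rodrigues (Suc l)))"
    by (simp only: add_Suc_right add_Suc funpow_Suc_right o_apply)
  also have "\<dots> = [:0, 1:] * (pderiv ^^ Suc (l + m)) (rodrigues l)
      + smult (of_nat (Suc (l + m))) ((pderiv ^^ (l + m)) (rodrigues l))"
    unfolding pderiv_rodrigues by (rule higher_pderiv_X_mult)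
  finally show ?thesis unfolding higher_pderiv_legendre
    by (simp add: algebra_simps)
qed

text \<open>Differentiating \<open>(z\<^sup>2 - 1) u_l = 2 (l + 1) u_{l + 1}\<close> exactly \<open>l + 1\<close> times, where \<open>u\<close> is
\<^term>\<open>rodrigues\<close>, and using \<open>u_{l + 1}' = z u_l\<close> for the derivatives of order \<open>l\<close> that arise.\<close>

lemma legendre_Suc_0:
  "(real l + 1) * poly (legendre_poly (Suc l)) z =
     (real l + 1) * z * poly (legendre_poly l) z + (z\<^sup>2 - 1) * poly (pderiv (legendre_poly l)) z"
proof -
  let ?D = "\<lambda>n. (pderiv ^^ n) (rodrigues l)"
  let ?X = "[:0, 1 :: real:]"
  have P: "legendre_poly l = ?D l" "pderiv (legendre_poly l) = ?D (Suc l)"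
     "legendre_poly (Suc l) = (pderiv ^^ Suc l) (rodrigues (Suc l))"
    using higher_pderiv_legendre[of 0 l] higher_pderiv_legendre[of 1 l] higher_pderiv_legendre[of 0 "Suc l"]
    by simp_all
  have PX: "(pderiv ^^ l) (?X * rodrigues l) = legendre_poly (Suc l)"
    unfolding P pderiv_rodrigues[symmetric] by (simp only: funpow_Suc_right o_apply)
  have "smult (2 * (real l + 1)) (legendre_poly (Suc l)) = (pderiv ^^ Suc l) ([:-1, 0, 1:] * rodrigues l)"
    unfolding P rodrigues_mult higher_pderiv_smult ..
  also have "[:-1, 0, 1:] * rodrigues l = ?X * (?X * rodrigues l) + smult (-1) (rodrigues l)"
    by simp
  also have "(pderiv ^^ Suc l) \<dots> = ?X * (pderiv ^^ Suc l) (?X * rodrigues l)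
      + smult (of_nat (Suc l)) ((pderiv ^^ l) (?X * rodrigues l)) - ?D (Suc l)"
    unfolding higher_pderiv_add higher_pderiv_smult higher_pderiv_X_mult by simp
  also have "\<dots> = ?X * (?X * ?D (Suc l) + smult (of_nat (Suc l)) (?D l))
      + smult (of_nat (Suc l)) (legendre_poly (Suc l)) - ?D (Suc l)"
    unfolding higher_pderiv_X_mult PX ..
  finally have "poly (smult (2 * (real l + 1)) (legendre_poly (Suc l))) z = poly \<dots> z" by (rule arg_cong)
  then show ?thesis unfolding P(1,2) by (simp add: power2_eq_square algebra_simps)
qed

text \<open>On the unit sphere the recurrence that raises the degree of \<^term>\<open>solid\<close> is that of the derivatives
of the Legendre polynomials. For order 0 it involves order \<open>-1\<close>, which is expressed by order 1 through
complex conjugation; this is why the case \<open>m = 0\<close> needs its own Legendre recurrence.\<close>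

lemma solid_on_sphere:
  assumes "z\<^sup>2 + (cmod p)\<^sup>2 = 1"
  shows "fact (l + m) * solid l (int m) (of_real z) p (cnj p) =
     (- p) ^ m * of_real (poly ((pderiv ^^ m) (legendre_poly l)) z)"
proof (induction l arbitrary: m)
  case 0
  have "(pderiv ^^ m) [:1 :: real:] = (if m = 0 then 1 else 0)"
    by (induction m) auto
  then show ?case by (simp add: legendre_poly_def)
next
  case (Suc l)
  have R: "(of_nat l + 1 + of_int n) * solid (Suc l) n (of_real z) p (cnj p) =
      of_real z * solid l n (of_real z) p (cnj p) - p * solid l (n - 1) (of_real z) p (cnj p)" for n
    using raise_solid(1)[of "Suc l" n "of_real z" p "cnj p"] by (simp add: add.commute)
  show ?case
  proof (cases m)
    case 0
    have "solid l (- 1) (of_real z) p (cnj p) = - cnj (solid l 1 (of_real z) p (cnj p))"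
      by (simp add: cnj_solid)
    then have "(of_nat l + 1) * (fact (Suc l) * solid (Suc l) 0 (of_real z) p (cnj p)) =
       (of_nat l + 1) * of_real z * (fact l * solid l 0 (of_real z) p (cnj p))
       + p * cnj (fact (l + 1) * solid l 1 (of_real z) p (cnj p))"
      using arg_cong[OF R[of 0], of "\<lambda>u. fact (Suc l) * u"] by (simp add: algebra_simps)
    also have "\<dots> = of_real ((real l + 1) * z * poly (legendre_poly l) z
        + - ((cmod p)\<^sup>2) * poly (pderiv (legendre_poly l)) z)"
      using Suc.IH[of 0] Suc.IH[of 1] complex_norm_square[of p]
      by (simp add: mult_ac del: fact_Suc)
    also have "- ((cmod p)\<^sup>2) = z\<^sup>2 - 1" using assms by simp
    also note legendre_Suc_0[symmetric]
    finally have *: "(of_nat l + 1) * (fact (Suc l) * solid (Suc l) 0 (of_real z) p (cnj p)) =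
      (of_nat l + 1) * of_real (poly (legendre_poly (Suc l)) z)" by simp
    have "(of_nat l + 1 :: complex) \<noteq> 0"
      by (rule of_nat_add_1_neq_0)
    with * have "fact (Suc l) * solid (Suc l) 0 (of_real z) p (cnj p) = of_real (poly (legendre_poly (Suc l)) z)"
      by (metis mult_left_cancel)
    then show ?thesis by (simp add: 0 del: fact_Suc)
  next
    case (Suc k)
    have "fact (Suc l + m) * solid (Suc l) (int m) (of_real z) p (cnj p) =
       fact (l + m) * ((of_nat l + 1 + of_int (int m)) * solid (Suc l) (int m) (of_real z) p (cnj p))"
      by (simp add: algebra_simps)
    also have "\<dots> = of_real z * (fact (l + m) * solid l (int m) (of_real z) p (cnj p))
       - p * ((of_nat l + of_nat k + 1) * (fact (l + k) * solid l (int k) (of_real z) p (cnj p)))"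
      unfolding R by (simp add: Suc algebra_simps)
    also have "\<dots> = (- p) ^ m * of_real (z * poly ((pderiv ^^ m) (legendre_poly l)) z
       + (real l + real k + 1) * poly ((pderiv ^^ k) (legendre_poly l)) z)"
      unfolding Suc.IH by (simp add: Suc algebra_simps)
    finally show ?thesis unfolding Suc legendre_Suc .
  qed
qed

definition fact_weight :: "nat \<Rightarrow> int \<Rightarrow> real" where
  "fact_weight l m = fact (nat (int l - m)) * fact (nat (int l + m))"

text \<open>The factor between the orthonormal harmonic and the harmonic polynomial with constant-free ladder relations.\<close>

definition harm_norm :: "nat \<Rightarrow> int \<Rightarrow> real" where
  "harm_norm l m = sqrt ((2 * real l + 1) / (4 * pi)) * sqrt (fact_weight l m)"

lemma fact_weight_pos: "fact_weight l m > 0"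
  by (simp add: fact_weight_def)

lemma cnj_regular: "cnj (regular l m x) = (-1) powi m * regular l (- m) x"
  by (simp add: regular_def cnj_solid axial_def)

text \<open>Since \<open>sqrt (1 - z\<^sup>2) e\<^sup>i\<^sup>\<phi> = x + i y\<close>, the angular definition is the polynomial of
\<open>solid_on_sphere\<close>; at the poles this needs no exception, both sides being 0 for nonzero order.\<close>

lemma sph_harm_eq_regular:
  assumes x: "norm x = 1" and m: "\<bar>m\<bar> \<le> int l"
  shows "sph_harm l m x = of_real (harm_norm l m) * regular l m x"
proof -
  have z: "\<bar>x $ 3\<bar> \<le> 1" using component_le_norm_cart[of x 3] x by simp
  have sph: "(x $ 3)\<^sup>2 + (cmod (planar x))\<^sup>2 = 1"
    using norm_vec3[of x] x by (simp add: planar_def cmod_power2)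
  then have sq: "sqrt (1 - (x $ 3)\<^sup>2) = cmod (planar x)"
    by (intro real_sqrt_unique) auto
  have ang: "sph_harm_ang l k (arccos (x $ 3)) (Arg (planar x)) =
      of_real (harm_norm l (int k)) * regular l (int k) x" if k: "k \<le> l" for k
  proof -
    have polar: "of_real (cmod (planar x)) ^ k * cis (real k * Arg (planar x)) = planar x ^ k"
      using DeMoivre2[of "cmod (planar x)" "Arg (planar x)" k] unfolding rcis_cmod_Arg by (simp add: rcis_def)
    have const: "sqrt ((2 * real l + 1) / (4 * pi) * (fact (l - k) / fact (l + k)))
        = harm_norm l (int k) / fact (l + k)"
    proof -
      have n: "nat (int l - int k) = l - k" "nat (int l + int k) = l + k" using k by auto
      have "(2 * real l + 1) / (4 * pi) * (fact (l - k) / fact (l + k))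
         = (2 * real l + 1) / (4 * pi) * (fact (l - k) * fact (l + k)) / (fact (l + k))\<^sup>2"
        by (simp add: power2_eq_square)
      then show ?thesis unfolding harm_norm_def fact_weight_def n
        by (simp only: real_sqrt_divide real_sqrt_mult real_sqrt_abs abs_of_nonneg fact_ge_zero)
    qed
    have reg: "fact (l + k) * regular l (int k) x =
        (- planar x) ^ k * of_real (poly ((pderiv ^^ k) (legendre_poly l)) (x $ 3))"
      unfolding regular_def axial_def by (rule solid_on_sphere[OF sph])
    have "sph_harm_ang l k (arccos (x $ 3)) (Arg (planar x)) =
        of_real (harm_norm l (int k)) * ((-1) ^ k * (of_real (cmod (planar x)) ^ k * cis (real k * Arg (planar x)))
          * of_real (poly ((pderiv ^^ k) (legendre_poly l)) (x $ 3))) / fact (l + k)"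
      unfolding sph_harm_ang_def assoc_legendre_def const using z
      by (simp add: cos_arccos_abs sq)
    also have "\<dots> = of_real (harm_norm l (int k)) * (fact (l + k) * regular l (int k) x) / fact (l + k)"
      unfolding polar reg by (simp add: power_minus[of "planar x"])
    finally show ?thesis by simp
  qed
  show ?thesis
  proof (cases "m \<ge> 0")
    case True
    then show ?thesis using ang[of "nat m"] m by (simp add: sph_harm_def planar_def)
  next
    case False
    have "fact_weight l (- m) = fact_weight l m" by (simp add: fact_weight_def)
    then have "harm_norm l (- m) = harm_norm l m" by (simp add: harm_norm_def)
    then have "sph_harm l m x = (-1) powi m * (of_real (harm_norm l m) * ((-1) powi (- m) * regular l m x))"
      using ang[of "nat (- m)"] m False by (simp add: sph_harm_def planar_def cnj_regular[of l "- m"])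
    also have "\<dots> = ((-1) powi m * (-1) powi (- m)) * (of_real (harm_norm l m) * regular l m x)"
      by (simp only: mult_ac)
    also have "(-1 :: complex) powi m * (-1) powi (- m) = 1"
      by (simp add: power_int_add[symmetric])
    finally show ?thesis by simp
  qed
qed

section \<open>Vector spherical harmonics as gradients of solid harmonics\<close>

lemma has_derivative_coords:
  "(axial has_derivative axial) (at x)" "(planar has_derivative planar) (at x)"
  "((\<lambda>x. cnj (planar x)) has_derivative (\<lambda>h. cnj (planar h))) (at x)"
proof -
  have "linear axial" "linear planar" "linear (\<lambda>x. cnj (planar x))"
    by (auto intro!: linearI simp: coord_simps scaleR_conv_of_real[where 'a = complex])
  then show "(axial has_derivative axial) (at x)" "(planar has_derivative planar) (at x)"
    "((\<lambda>x. cnj (planar x)) has_derivative (\<lambda>h. cnj (planar h))) (at x)"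
    by (simp_all add: bounded_linear_imp_has_derivative linear_conv_bounded_linear)
qed

definition regular_deriv :: "nat \<Rightarrow> int \<Rightarrow> real ^ 3 \<Rightarrow> real ^ 3 \<Rightarrow> complex" where
  "regular_deriv l m x h = axial h * lower l m (axial x) (planar x) (cnj (planar x))
     + cnj (planar h) / 2 * lower l (m + 1) (axial x) (planar x) (cnj (planar x))
     - planar h / 2 * lower l (m - 1) (axial x) (planar x) (cnj (planar x))"

definition irregular_deriv :: "nat \<Rightarrow> int \<Rightarrow> real ^ 3 \<Rightarrow> real ^ 3 \<Rightarrow> complex" where
  "irregular_deriv l m x h = - axial h * irregular (Suc l) m x
     + cnj (planar h) / 2 * irregular (Suc l) (m + 1) x - planar h / 2 * irregular (Suc l) (m - 1) x"

lemma has_derivative_regular: "(regular l m has_derivative regular_deriv l m x) (at x)"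
  unfolding regular_def regular_deriv_def by (rule has_derivative_solid[OF has_derivative_coords])

lemma has_derivative_inverse_norm:
  fixes x :: "real ^ 3"
  assumes "norm x = 1"
  shows "((\<lambda>y. of_real (inverse (norm y)) :: complex) has_derivative (\<lambda>h. - of_real (x \<bullet> h))) (at x)"
proof -
  have "x \<noteq> 0" using assms by auto
  then have "(norm has_derivative (\<lambda>h. h \<bullet> x)) (at x)"
    using has_derivative_norm[of x] assms by (simp add: sgn_div_norm)
  from Deriv.has_derivative_inverse[OF _ this]
  have "((\<lambda>y. inverse (norm y)) has_derivative (\<lambda>h. - (x \<bullet> h))) (at x)"
    using assms \<open>x \<noteq> 0\<close> by (simp add: inner_commute)
  from bounded_linear.has_derivative[OF bounded_linear_of_real[where 'a = complex] this]
  show ?thesis by (simp only: of_real_minus)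
qed

lemma has_derivative_irregular:
  assumes x: "norm x = 1" and m: "\<bar>m\<bar> \<le> int l"
  shows "(irregular l m has_derivative irregular_deriv l m x) (at x)"
  unfolding irregular_def irregular_deriv_def
proof (rule has_derivative_solid_irreg[OF has_derivative_coords])
  show "((\<lambda>x. of_real (inverse (norm x))) has_derivative
     (\<lambda>h. - (2 * axial x * axial h + planar h * cnj (planar x) + planar x * cnj (planar h)) / 2 *
       of_real (inverse (norm x)) ^ 3)) (at x)"
    by (rule has_derivative_eq_rhs[OF has_derivative_inverse_norm[OF x]])
       (simp add: fun_eq_iff x inner_vec3 axial_def planar_def complex_eq_iff)
  show "(of_real (inverse (norm x)))\<^sup>2 * ((axial x)\<^sup>2 + planar x * cnj (planar x)) = 1"
    by (simp add: norm_coords x)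
qed (rule m)

lemma sgn_scaleR: "sgn x = inverse (norm x) *\<^sub>R x" for x :: "real ^ 3"
  by (simp add: sgn_div_norm)

lemma regular_sgn: "regular l m (sgn x) = of_real (inverse (norm x)) ^ l * regular l m x"
  unfolding regular_def sgn_scaleR coord_simps complex_cnj_mult complex_cnj_complex_of_real
  by (rule solid_scale)

lemma regular_deriv_sgn:
  "regular_deriv (Suc l) m (sgn x) h = of_real (inverse (norm x)) ^ l * regular_deriv (Suc l) m x h"
  unfolding regular_deriv_def lower_Suc regular_def[symmetric] regular_sgn
  by (simp add: algebra_simps)

lemma irregular_sgn:
  assumes "x \<noteq> 0"
  shows "irregular l m (sgn x) = of_real (norm x) ^ (l + 1) * irregular l m x"
proof -
  define c :: complex where "c = of_real (inverse (norm x))"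
  have c: "c \<noteq> 0" using assms by (simp add: c_def)
  have "irregular l m (sgn x) = solid_irreg l m (c * axial x) (c * planar x) (c * cnj (planar x)) (c / c)"
    using assms c unfolding irregular_def by (simp add: norm_sgn) (simp add: sgn_scaleR coord_simps c_def)
  also have "\<dots> = irregular l m x / c ^ (l + 1)"
    unfolding solid_irreg_scale[OF c] by (simp add: irregular_def c_def)
  finally show ?thesis by (simp add: c_def field_simps power_inverse)
qed

lemma irregular_deriv_sgn:
  assumes "x \<noteq> 0"
  shows "irregular_deriv l m (sgn x) h = of_real (norm x) ^ (l + 2) * irregular_deriv l m x h"
  unfolding irregular_deriv_def irregular_sgn[OF assms] by (simp add: algebra_simps)

text \<open>The extension constant along rays is \<open>R_l^m(y) / |y|\<^sup>l\<close>, and the derivative of \<open>1 / |y|\<close> at a unit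
vector \<open>x\<close> in the direction \<open>h\<close> is \<open>- x \<bullet> h\<close>.\<close>

lemma has_derivative_sph_harm:
  assumes x: "norm x = 1" and m: "\<bar>m\<bar> \<le> int l"
  shows "((\<lambda>y. sph_harm l m (sgn y)) has_derivative (\<lambda>h. of_real (harm_norm l m) *
     (regular_deriv l m x h - of_nat l * of_real (x \<bullet> h) * regular l m x))) (at x)"
proof -
  have "((\<lambda>y. of_real (harm_norm l m) * (of_real (inverse (norm y)) ^ l * regular l m y)) has_derivative
     (\<lambda>h. of_real (harm_norm l m) *
       (regular_deriv l m x h - of_nat l * of_real (x \<bullet> h) * regular l m x))) (at x)"
    by (rule has_derivative_eq_rhs[OF has_derivative_mult_right[OF has_derivative_mult[OF
          has_derivative_power[OF has_derivative_inverse_norm[OF x]] has_derivative_regular]]])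
       (simp add: fun_eq_iff x algebra_simps)
  then show ?thesis
  proof (rule has_derivative_transform_within_open[of _ _ _ _ "- {0}"])
    show "open (- {0 :: real ^ 3})" "x \<in> - {0}" using x by auto
    fix y :: "real ^ 3" assume "y \<in> - {0}"
    then have "norm (sgn y) = 1" by (simp add: norm_sgn)
    from sph_harm_eq_regular[OF this m]
    show "of_real (harm_norm l m) * (of_real (inverse (norm y)) ^ l * regular l m y) = sph_harm l m (sgn y)"
      by (simp add: regular_sgn)
  qed
qed

lemma surface_grad_nth:
  assumes "((\<lambda>y. f (sgn y)) has_derivative D) (at x)"
  shows "surface_grad f x $ i = D (axis i 1)"
  unfolding surface_grad_def using frechet_derivative_at[OF assms] by simp

text \<open>The radial part in the definition of \<open>W\<close> cancels the one that the division by \<open>|y|\<^sup>l\<close> creates.\<close>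

lemma complex_W_nth:
  assumes x: "norm x = 1" and m: "\<bar>m\<bar> \<le> int l"
  shows "complex_W l m x $ i = of_real (harm_norm l m) * regular_deriv l m x (axis i 1)"
  unfolding complex_W_def vec_W_def
  by (simp add: surface_grad_nth[OF has_derivative_sph_harm[OF x m]] sph_harm_eq_regular[OF x m]
      inner_axis cvec_def algebra_simps)

text \<open>Here the radial part completes the derivative of \<open>R_l^m(y) / |y|\<^sup>2\<^sup>l\<^sup>+\<^sup>1\<close>. Computing the derivative of
this function by the product rule and by the ladder relation gives the same linear map.\<close>

lemma complex_V_nth:
  assumes x: "norm x = 1" and m: "\<bar>m\<bar> \<le> int l"
  shows "vec_V l (sph_harm l m) x $ i =
     of_real (harm_norm l m / fact_weight l m) * irregular_deriv l m x (axis i 1)"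
proof -
  have eq: "irregular l m = (\<lambda>y. of_real (fact_weight l m) * (regular l m y * of_real (inverse (norm y)) ^ (2 * l + 1)))"
    by (simp add: fun_eq_iff irregular_def solid_irreg_def regular_def fact_weight_def)
  have "((\<lambda>y. of_real (fact_weight l m) * (regular l m y * of_real (inverse (norm y)) ^ (2 * l + 1)))
     has_derivative (\<lambda>h. of_real (fact_weight l m) *
       (regular_deriv l m x h - (2 * of_nat l + 1) * of_real (x \<bullet> h) * regular l m x))) (at x)"
    by (rule has_derivative_eq_rhs[OF has_derivative_mult_right[OF has_derivative_mult[OF
          has_derivative_regular has_derivative_power[OF has_derivative_inverse_norm[OF x]]]]])
       (simp add: fun_eq_iff x algebra_simps)
  then have "(irregular l m has_derivative (\<lambda>h. of_real (fact_weight l m) *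
       (regular_deriv l m x h - (2 * of_nat l + 1) * of_real (x \<bullet> h) * regular l m x))) (at x)"
    unfolding eq .
  then have "irregular_deriv l m x = (\<lambda>h. of_real (fact_weight l m) *
       (regular_deriv l m x h - (2 * of_nat l + 1) * of_real (x \<bullet> h) * regular l m x))"
    by (rule has_derivative_unique[OF has_derivative_irregular[OF x m]])
  then have "of_real (harm_norm l m / fact_weight l m) * irregular_deriv l m x (axis i 1) =
     of_real (harm_norm l m) * (regular_deriv l m x (axis i 1)
        - (2 * of_nat l + 1) * of_real (x $ i) * regular l m x)"
    using fact_weight_pos[of l m] by (simp add: inner_axis)
  then show ?thesis
    unfolding vec_V_def
    by (simp add: surface_grad_nth[OF has_derivative_sph_harm[OF x m]] sph_harm_eq_regular[OF x m]
      inner_axis cvec_def algebra_simps)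
qed

section \<open>The expansion for complex harmonics\<close>

lemma irreg_solid_eq:
  assumes a: "a \<noteq> 0" and m: "\<bar>m\<bar> \<le> int l"
  shows "irreg_solid l m a = irregular l m a / of_real (sqrt (fact_weight l m))"
proof -
  have n: "norm (sgn a) = 1" using a by (simp add: norm_sgn)
  have c: "sqrt (4 * pi / (2 * real l + 1)) * harm_norm l m = sqrt (fact_weight l m)"
    unfolding harm_norm_def mult.assoc[symmetric] real_sqrt_mult[symmetric] by simp
  have irr: "irregular l m (sgn a) = of_real (fact_weight l m) * regular l m (sgn a)"
    by (simp add: irregular_def solid_irreg_def regular_def fact_weight_def n)
  have "irreg_solid l m a = of_real (sqrt (4 * pi / (2 * real l + 1)) * harm_norm l m)
      * regular l m (sgn a) / of_real (norm a ^ (l + 1))"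
    unfolding irreg_solid_def sph_harm_eq_regular[OF n m] by simp
  also have "\<dots> = of_real (sqrt (fact_weight l m)) * regular l m (sgn a) / of_real (norm a ^ (l + 1))"
    unfolding c ..
  also have "\<dots> = (of_real (fact_weight l m) * regular l m (sgn a)) / of_real (norm a ^ (l + 1)) / of_real (sqrt (fact_weight l m))"
  proof -
    have "fact_weight l m = sqrt (fact_weight l m) * sqrt (fact_weight l m)" using fact_weight_pos[of l m] by simp
    then have "of_real (fact_weight l m) = (of_real (sqrt (fact_weight l m)) * of_real (sqrt (fact_weight l m)) :: complex)"
      by (metis of_real_mult)
    then show ?thesis using fact_weight_pos[of l m] by simp
  qed
  also have "\<dots> = irregular l m a / of_real (sqrt (fact_weight l m))"
    unfolding irr[symmetric] irregular_sgn[OF a] using a by simp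
  finally show ?thesis .
qed

text \<open>The binomial coefficients of \<^term>\<open>H_coeff\<close> are the ratio of the factorial weights of
\<open>(l + k, m - \<mu>)\<close>, \<open>(k, \<mu>)\<close> and \<open>(l, m)\<close>: the first converts \<open>I\<close> to its constant-free
normalisation, the second cancels against the norm of \<open>Y_k^\<mu>\<close>, and the third is left over
independently of \<open>k\<close> and \<open>\<mu>\<close>.\<close>

lemma H_coeff_harm_norm:
  assumes a: "a \<noteq> 0" and m: "\<bar>m\<bar> \<le> int l" and \<mu>: "\<bar>\<mu>\<bar> \<le> int k"
  shows "H_coeff l k m \<mu> a * of_real (harm_norm k \<mu>) =
    of_real (harm_norm l m / fact_weight l m) * ((-1) powi (int k + \<mu>) * irregular (l + k) (m - \<mu>) a)"
proof -
  have b1: "real (nat (int l + int k + \<mu> - m) choose nat (int k + \<mu>)) =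
     fact (nat (int (l + k) - (m - \<mu>))) / (fact (nat (int k + \<mu>)) * fact (nat (int l - m)))"
  proof -
    have "nat (int l + int k + \<mu> - m) - nat (int k + \<mu>) = nat (int l - m)"
      "nat (int (l + k) - (m - \<mu>)) = nat (int l + int k + \<mu> - m)" using m \<mu> by auto
    moreover have "nat (int k + \<mu>) \<le> nat (int l + int k + \<mu> - m)"
      "nat (int k - \<mu>) \<le> nat (int l + int k + m - \<mu>)" using m by auto
    ultimately show ?thesis by (simp only: binomial_fact)
  qed
  have b2: "real (nat (int l + int k + m - \<mu>) choose nat (int k - \<mu>)) =
     fact (nat (int (l + k) + (m - \<mu>))) / (fact (nat (int k - \<mu>)) * fact (nat (int l + m)))"
  proof -
    have "nat (int l + int k + m - \<mu>) - nat (int k - \<mu>) = nat (int l + m)"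
      "nat (int (l + k) + (m - \<mu>)) = nat (int l + int k + m - \<mu>)" using m \<mu> by auto
    moreover have "nat (int k + \<mu>) \<le> nat (int l + int k + \<mu> - m)"
      "nat (int k - \<mu>) \<le> nat (int l + int k + m - \<mu>)" using m by auto
    ultimately show ?thesis by (simp only: binomial_fact)
  qed
  let ?L = "fact_weight (l + k) (m - \<mu>)"
  have b: "real (nat (int l + int k + \<mu> - m) choose nat (int k + \<mu>)) *
      real (nat (int l + int k + m - \<mu>) choose nat (int k - \<mu>)) = ?L / (fact_weight k \<mu> * fact_weight l m)"
    unfolding b1 b2 fact_weight_def by (simp add: mult_ac)
  have "sqrt ((2 * real l + 1) / (2 * real k + 1)) * harm_norm k \<mu> = sqrt ((2 * real l + 1) / (4 * pi)) * sqrt (fact_weight k \<mu>)"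
    unfolding harm_norm_def mult.assoc[symmetric] real_sqrt_mult[symmetric] by simp
  then have c: "sqrt ((2 * real l + 1) / (2 * real k + 1)) * sqrt (?L / (fact_weight k \<mu> * fact_weight l m)) * harm_norm k \<mu>
     = sqrt (?L) * (harm_norm l m / fact_weight l m)"
    using fact_weight_pos[of k \<mu>] fact_weight_pos[of l m]
    by (simp add: harm_norm_def real_sqrt_divide real_sqrt_mult field_simps)
  have irr: "irreg_solid (l + k) (m - \<mu>) a = irregular (l + k) (m - \<mu>) a / of_real (sqrt ?L)"
    using m \<mu> by (intro irreg_solid_eq a) auto
  have "H_coeff l k m \<mu> a * of_real (harm_norm k \<mu>) = (-1) powi (int k + \<mu>) *
     (irregular (l + k) (m - \<mu>) a / of_real (sqrt ?L)) *
     of_real (sqrt ((2 * real l + 1) / (2 * real k + 1)) * sqrt (?L / (fact_weight k \<mu> * fact_weight l m)) * harm_norm k \<mu>)"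
    unfolding H_coeff_def b irr by (simp only: of_real_mult mult_ac)
  also have "\<dots> = of_real (harm_norm l m / fact_weight l m) * ((-1) powi (int k + \<mu>) * irregular (l + k) (m - \<mu>) a)"
    unfolding c using fact_weight_pos[of "l + k" "m - \<mu>"] by simp
  finally show ?thesis .
qed

text \<open>One component of the expansion, before passing to real harmonics. The components of \<open>W\<close> of
degree \<open>n + 1\<close> are built from \<open>R\<close> of degree \<open>n\<close>, so the term of index \<open>n\<close> is the
combination of the \<open>n\<close>-th terms of three translation series for harmonics of degree \<open>l + 1\<close>.\<close>

lemma complex_expansion:
  fixes r a :: "real ^ 3"
  assumes ra: "norm r < norm a" and r: "r \<noteq> 0" and m: "\<bar>m\<bar> \<le> int l"
  shows "(\<lambda>n. \<Sum>\<mu> = - int (Suc n)..int (Suc n).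
       of_real (norm r ^ n) * H_coeff l (Suc n) m \<mu> a * complex_W (Suc n) \<mu> (sgn r) $ i)
     sums (of_real (norm (r + a) powi (- int l - 2)) * vec_V l (sph_harm l m) (sgn (r + a)) $ i)"
proof -
  define C :: complex where "C = of_real (harm_norm l m / fact_weight l m)"
  let ?h = "axis i 1 :: real ^ 3"
  let ?T = "\<lambda>M n. \<Sum>\<mu> = - int n..int n. (-1) powi (int n + \<mu>) * regular n \<mu> r * irregular (Suc l + n) (M - \<mu>) a"
  have a: "a \<noteq> 0" using ra by auto
  have ra0: "r + a \<noteq> 0"
  proof
    assume "r + a = 0"
    then have "a = - r" by (simp add: add_eq_0_iff)
    then show False using ra by simp
  qed
  \<comment> \<open>The three sums \<open>?T\<close> are the \<open>n\<close>-th terms of the translation series of the harmonics that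
    make up \<open>irregular_deriv l m\<close>.\<close>
  have level: "(\<Sum>\<mu> = - int (Suc n)..int (Suc n).
       of_real (norm r ^ n) * H_coeff l (Suc n) m \<mu> a * complex_W (Suc n) \<mu> (sgn r) $ i)
     = C * (- axial ?h * ?T m n + cnj (planar ?h) / 2 * ?T (m + 1) n - planar ?h / 2 * ?T (m - 1) n)" for n
  proof -
    have "of_real (norm r ^ n) * H_coeff l (Suc n) m \<mu> a * complex_W (Suc n) \<mu> (sgn r) $ i =
        C * ((-1) powi (int (Suc n) + \<mu>) * regular_deriv (Suc n) \<mu> r ?h * irregular (l + Suc n) (m - \<mu>) a)"
      if "\<mu> \<in> {- int (Suc n)..int (Suc n)}" for \<mu>
    proof -
      have \<mu>: "\<bar>\<mu>\<bar> \<le> int (Suc n)" using that by auto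
      have n: "norm (sgn r) = 1" using r by (simp add: norm_sgn)
      have "of_real (norm r ^ n) * H_coeff l (Suc n) m \<mu> a * complex_W (Suc n) \<mu> (sgn r) $ i =
         (H_coeff l (Suc n) m \<mu> a * of_real (harm_norm (Suc n) \<mu>)) *
         ((of_real (norm r) * of_real (inverse (norm r))) ^ n * regular_deriv (Suc n) \<mu> r ?h)"
        unfolding complex_W_nth[OF n \<mu>] regular_deriv_sgn power_mult_distrib
        by (simp only: of_real_power mult_ac)
      also have "of_real (norm r) * of_real (inverse (norm r)) = (1 :: complex)"
        using r by simp
      finally show ?thesis unfolding H_coeff_harm_norm[OF a m \<mu>] C_def by (simp add: mult_ac)
    qed
    then have "(\<Sum>\<mu> = - int (Suc n)..int (Suc n).
       of_real (norm r ^ n) * H_coeff l (Suc n) m \<mu> a * complex_W (Suc n) \<mu> (sgn r) $ i) =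
       C * (\<Sum>\<mu> = - int (Suc n)..int (Suc n).
         (-1) powi (int (Suc n) + \<mu>) * regular_deriv (Suc n) \<mu> r ?h * irregular (l + Suc n) (m - \<mu>) a)"
      unfolding sum_distrib_left by (intro sum.cong refl) blast
    also have "(\<Sum>\<mu> = - int (Suc n)..int (Suc n).
         (-1) powi (int (Suc n) + \<mu>) * regular_deriv (Suc n) \<mu> r ?h * irregular (l + Suc n) (m - \<mu>) a)
       = (\<Sum>\<mu> = - int n..int n. (-1) powi (int n + \<mu>) * regular n \<mu> r *
         (- axial ?h * irregular (l + Suc n) (m - \<mu>) a
          + cnj (planar ?h) / 2 * irregular (l + Suc n) (m - (\<mu> - 1)) a
          - planar ?h / 2 * irregular (l + Suc n) (m - (\<mu> + 1)) a))"
      unfolding regular_deriv_def lower_Suc regular_def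
      by (rule ladder_sum[where G = "\<lambda>\<mu>. irregular (l + Suc n) (m - \<mu>) a", symmetric])
    also have "\<dots> = - axial ?h * ?T m n + cnj (planar ?h) / 2 * ?T (m + 1) n - planar ?h / 2 * ?T (m - 1) n"
      unfolding sum_distrib_left sum_subtractf[symmetric] sum.distrib[symmetric]
      by (intro sum.cong refl) (simp add: algebra_simps)
    finally show ?thesis .
  qed
  have T: "?T M sums irregular (Suc l) M (r + a)" if "\<bar>M\<bar> \<le> int (Suc l)" for M
    by (rule irregular_translation[OF ra r that])
  have "(\<lambda>n. C * (- axial ?h * ?T m n + cnj (planar ?h) / 2 * ?T (m + 1) n - planar ?h / 2 * ?T (m - 1) n))
     sums (C * irregular_deriv l m (r + a) ?h)"
    unfolding irregular_deriv_def using m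
    by (intro sums_mult sums_add sums_diff T) auto
  moreover have "C * irregular_deriv l m (r + a) ?h =
     of_real (norm (r + a) powi (- int l - 2)) * vec_V l (sph_harm l m) (sgn (r + a)) $ i"
  proof -
    have n: "norm (sgn (r + a)) = 1" using ra0 by (simp add: norm_sgn)
    have "norm (r + a) ^ (l + 2) = norm (r + a) powi (int l + 2)"
      by (simp add: power_int_def nat_add_distrib)
    then have "norm (r + a) powi (- int l - 2) * norm (r + a) ^ (l + 2) = 1"
      using power_int_add[of "norm (r + a)" "- int l - 2" "int l + 2"] ra0 by simp
    then have one: "of_real (norm (r + a) powi (- int l - 2)) * of_real (norm (r + a)) ^ (l + 2) = (1 :: complex)"
      unfolding of_real_power[symmetric] of_real_mult[symmetric] by (simp only: of_real_1)
    have "of_real (norm (r + a) powi (- int l - 2)) * vec_V l (sph_harm l m) (sgn (r + a)) $ i =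
       (of_real (norm (r + a) powi (- int l - 2)) * of_real (norm (r + a)) ^ (l + 2)) *
       (C * irregular_deriv l m (r + a) ?h)"
      unfolding complex_V_nth[OF n m] irregular_deriv_sgn[OF ra0] C_def by (simp only: mult_ac)
    then show ?thesis unfolding one by simp
  qed
  ultimately show ?thesis by (simp only: level)
qed

section \<open>Real harmonics\<close>

lemma real_comb_linear:
  obtains \<alpha> \<beta> where "\<And>F. real_comb F m = \<alpha> * F m + \<beta> * F (- m)"
proof (cases "m = 0")
  case True
  then show ?thesis using that[of 1 0] by (simp add: real_comb_def)
next
  case False
  show ?thesis
  proof (cases "m > 0")
    case True
    then show ?thesis
      using that[of "(-1) powi m / of_real (sqrt 2)" "1 / of_real (sqrt 2)"]
      by (simp add: real_comb_def add_divide_distrib add.commute)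
  next
    case False
    with \<open>m \<noteq> 0\<close> show ?thesis
      using that[of "\<i> / of_real (sqrt 2)" "- (\<i> * (-1) powi m) / of_real (sqrt 2)"]
      by (simp add: real_comb_def diff_divide_distrib right_diff_distrib)
  qed
qed

lemma real_comb_cong:
  "F m = G m \<Longrightarrow> F (- m) = G (- m) \<Longrightarrow> real_comb F m = real_comb G m"
  by (rule real_comb_linear[of m]) simp

lemma real_comb_mult: "c * real_comb F m = real_comb (\<lambda>k. c * F k) m"
  by (rule real_comb_linear[of m]) (simp add: algebra_simps)

lemma real_comb_mult_right: "real_comb F m * c = real_comb (\<lambda>k. F k * c) m"
  by (rule real_comb_linear[of m]) (simp add: algebra_simps)

lemma real_comb_add: "real_comb F m + real_comb G m = real_comb (\<lambda>k. F k + G k) m"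
  by (rule real_comb_linear[of m]) (simp add: algebra_simps)

lemma real_comb_sum: "(\<Sum>x\<in>A. real_comb (F x) m) = real_comb (\<lambda>k. \<Sum>x\<in>A. F x k) m"
  by (rule real_comb_linear[of m]) (simp add: sum.distrib sum_distrib_left)

lemma real_comb_sums:
  assumes "(\<lambda>n. F n m) sums G m" "(\<lambda>n. F n (- m)) sums G (- m)"
  shows "(\<lambda>n. real_comb (F n) m) sums real_comb G m"
  by (rule real_comb_linear[of m]) (auto intro!: sums_mult sums_add assms)

lemma real_comb_has_derivative:
  assumes "(F m has_derivative D m) (at x)" "(F (- m) has_derivative D (- m)) (at x)"
  shows "((\<lambda>y. real_comb (\<lambda>k. F k y) m) has_derivative (\<lambda>h. real_comb (\<lambda>k. D k h) m)) (at x)"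
  by (rule real_comb_linear[of m])
     (auto intro!: has_derivative_mult_right has_derivative_add assms)

text \<open>The unitary change of basis from the orders \<open>\<plusminus>\<mu>\<close> to the real harmonics, solved for the complex ones.\<close>

lemma real_comb_inverse:
  shows "\<mu> < 0 \<Longrightarrow> 1 / of_real (sqrt 2) * (real_comb F (- \<mu>) - \<i> * real_comb F \<mu>) = F \<mu>"
    and "\<mu> > 0 \<Longrightarrow> (-1) powi \<mu> / of_real (sqrt 2) * (real_comb F \<mu> + \<i> * real_comb F (- \<mu>)) = F \<mu>"
proof -
  define c :: complex where "c = 1 / of_real (sqrt 2)"
  define e :: complex where "e = (-1) powi \<mu>"
  have c2: "c * c = 1 / 2"
  proof -
    have "of_real (sqrt 2) * of_real (sqrt 2) = (2 :: complex)"
      by (metis of_real_mult of_real_numeral real_sqrt_mult_self abs_numeral)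
    then show ?thesis by (simp add: c_def)
  qed
  have c: "1 / of_real (sqrt 2) = c" "x / of_real (sqrt 2) = x * c" for x :: complex
    by (simp_all add: c_def)
  have e: "(-1) powi (- \<mu>) = e" "e * e = 1"
    by (simp_all add: e_def power_int_minus_left)
  have neg: "c * (c * (A + e * B) - \<i> * (\<i> * c * (A - e * B))) = (c * c) * (2 * A)" for A B
    by (simp add: algebra_simps)
  have pos: "e * c * (c * (A + e * B) + \<i> * (\<i> * c * (A - e * B))) = (c * c) * (2 * (e * e * B))" for A B
    by (simp add: algebra_simps)
  show "1 / of_real (sqrt 2) * (real_comb F (- \<mu>) - \<i> * real_comb F \<mu>) = F \<mu>" if "\<mu> < 0"
    using that neg[of "F \<mu>" "F (- \<mu>)"] unfolding real_comb_def c e_def[symmetric] e c2 by simp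
  show "(-1) powi \<mu> / of_real (sqrt 2) * (real_comb F \<mu> + \<i> * real_comb F (- \<mu>)) = F \<mu>" if "\<mu> > 0"
    using that pos[of "F (- \<mu>)" "F \<mu>"] unfolding real_comb_def c e_def[symmetric] e c2 by simp
qed

text \<open>The surface gradient is linear only on functions differentiable at the point, so the derivatives of the
extended harmonics are combined first, and the gradient is taken afterwards.\<close>

lemma real_fields_nth:
  assumes x: "norm x = 1" and m: "\<bar>m\<bar> \<le> int l"
  shows "real_W l m x $ i = real_comb (\<lambda>k. complex_W l k x $ i) m"
    and "real_V l m x $ i = real_comb (\<lambda>k. vec_V l (sph_harm l k) x $ i) m"
proof -
  have m': "\<bar>- m\<bar> \<le> int l" using m by simp
  define D where "D = (\<lambda>k h. of_real (harm_norm l k) *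
     (regular_deriv l k x h - of_nat l * of_real (x \<bullet> h) * regular l k x))"
  have d: "((\<lambda>y. sph_harm l k (sgn y)) has_derivative D k) (at x)" if "\<bar>k\<bar> \<le> int l" for k
    unfolding D_def by (rule has_derivative_sph_harm[OF x that])
  have "((\<lambda>y. real_sph_harm l m (sgn y)) has_derivative (\<lambda>h. real_comb (\<lambda>k. D k h) m)) (at x)"
    unfolding real_sph_harm_def by (rule real_comb_has_derivative[OF d[OF m] d[OF m']])
  then have g: "surface_grad (real_sph_harm l m) x $ i = real_comb (\<lambda>k. D k (axis i 1)) m"
    by (rule surface_grad_nth)
  have gk: "surface_grad (sph_harm l k) x $ i = D k (axis i 1)" if "\<bar>k\<bar> \<le> int l" for k
    by (rule surface_grad_nth[OF d[OF that]])
  show "real_W l m x $ i = real_comb (\<lambda>k. complex_W l k x $ i) m"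
  proof -
    have "real_W l m x $ i =
        real_comb (\<lambda>k. D k (axis i 1)) m + of_nat l * real_comb (\<lambda>k. sph_harm l k x) m * cvec x $ i"
      by (simp add: real_W_def vec_W_def g real_sph_harm_def)
    also have "\<dots> = real_comb (\<lambda>k. D k (axis i 1) + of_nat l * sph_harm l k x * cvec x $ i) m"
      unfolding real_comb_mult real_comb_mult_right real_comb_add ..
    also have "\<dots> = real_comb (\<lambda>k. complex_W l k x $ i) m"
      by (rule real_comb_cong) (simp_all add: complex_W_def vec_W_def gk[OF m] gk[OF m'])
    finally show ?thesis .
  qed
  show "real_V l m x $ i = real_comb (\<lambda>k. vec_V l (sph_harm l k) x $ i) m"
  proof -
    have "real_V l m x $ i =
        real_comb (\<lambda>k. D k (axis i 1)) m + - (of_nat l + 1) * real_comb (\<lambda>k. sph_harm l k x) m * cvec x $ i"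
      by (simp add: real_V_def vec_V_def g real_sph_harm_def algebra_simps)
    also have "\<dots> = real_comb (\<lambda>k. D k (axis i 1) + - (of_nat l + 1) * sph_harm l k x * cvec x $ i) m"
      unfolding real_comb_mult real_comb_mult_right real_comb_add ..
    also have "\<dots> = real_comb (\<lambda>k. vec_V l (sph_harm l k) x $ i) m"
      by (rule real_comb_cong) (simp_all add: vec_V_def gk[OF m] gk[OF m'] algebra_simps)
    finally show ?thesis .
  qed
qed

lemma complex_W_eq_real_W:
  assumes x: "norm x = 1" and \<mu>: "\<bar>\<mu>\<bar> \<le> int n"
  shows "\<mu> < 0 \<Longrightarrow> (1 / of_real (sqrt 2) * c) *s (real_W n (- \<mu>) x - \<i> *s real_W n \<mu> x) = c *s complex_W n \<mu> x"
    and "\<mu> > 0 \<Longrightarrow> ((-1) powi \<mu> / of_real (sqrt 2) * c) *s (real_W n \<mu> x + \<i> *s real_W n (- \<mu>) x) = c *s complex_W n \<mu> x"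
    and "c *s real_W n 0 x = c *s complex_W n 0 x"
proof -
  have \<mu>': "\<bar>- \<mu>\<bar> \<le> int n" using \<mu> by simp
  note R = real_fields_nth(1)[OF x \<mu>] real_fields_nth(1)[OF x \<mu>']
  show "(1 / of_real (sqrt 2) * c) *s (real_W n (- \<mu>) x - \<i> *s real_W n \<mu> x) = c *s complex_W n \<mu> x" if "\<mu> < 0"
    unfolding vec_eq_iff
  proof
    fix i
    show "((1 / of_real (sqrt 2) * c) *s (real_W n (- \<mu>) x - \<i> *s real_W n \<mu> x)) $ i = (c *s complex_W n \<mu> x) $ i"
      unfolding vector_smult_component vector_minus_component R
      using arg_cong[OF real_comb_inverse(1)[OF that, of "\<lambda>k. complex_W n k x $ i"], of "\<lambda>u. c * u"]
      by (simp only: mult.assoc mult.left_commute[of c])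
  qed
  show "((-1) powi \<mu> / of_real (sqrt 2) * c) *s (real_W n \<mu> x + \<i> *s real_W n (- \<mu>) x) = c *s complex_W n \<mu> x" if "\<mu> > 0"
    unfolding vec_eq_iff
  proof
    fix i
    show "(((-1) powi \<mu> / of_real (sqrt 2) * c) *s (real_W n \<mu> x + \<i> *s real_W n (- \<mu>) x)) $ i = (c *s complex_W n \<mu> x) $ i"
      unfolding vector_smult_component vector_add_component R
      using arg_cong[OF real_comb_inverse(2)[OF that, of "\<lambda>k. complex_W n k x $ i"], of "\<lambda>u. c * u"]
      by (simp only: mult.assoc mult.left_commute[of c])
  qed
  show "c *s real_W n 0 x = c *s complex_W n 0 x"
    using real_fields_nth(1)[OF x, of 0 n] by (simp add: vec_eq_iff real_comb_def)
qed

lemma sum_complex_W_eq_real_W: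
  assumes x: "norm x = 1"
  shows "(\<Sum>\<mu> = - int n..-1. (1 / of_real (sqrt 2) * c \<mu>) *s (real_W n (- \<mu>) x - \<i> *s real_W n \<mu> x))
       + (\<Sum>\<mu> = 1..int n. ((-1) powi \<mu> / of_real (sqrt 2) * c \<mu>) *s (real_W n \<mu> x + \<i> *s real_W n (- \<mu>) x))
       + c 0 *s real_W n 0 x
     = (\<Sum>\<mu> = - int n..int n. c \<mu> *s complex_W n \<mu> x)"
proof -
  have split: "{- int n..int n} = {- int n..-1} \<union> {1..int n} \<union> {0}" by auto
  have "(\<Sum>\<mu> = - int n..int n. c \<mu> *s complex_W n \<mu> x) =
     (\<Sum>\<mu> = - int n..-1. c \<mu> *s complex_W n \<mu> x) + (\<Sum>\<mu> = 1..int n. c \<mu> *s complex_W n \<mu> x)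
       + c 0 *s complex_W n 0 x"
  proof -
    have "(\<Sum>\<mu> = - int n..int n. c \<mu> *s complex_W n \<mu> x) =
       (\<Sum>\<mu> \<in> {- int n..-1} \<union> {1..int n}. c \<mu> *s complex_W n \<mu> x) + (\<Sum>\<mu> \<in> {0}. c \<mu> *s complex_W n \<mu> x)"
      unfolding split by (rule sum.union_disjoint) auto
    also have "(\<Sum>\<mu> \<in> {- int n..-1} \<union> {1..int n}. c \<mu> *s complex_W n \<mu> x) =
       (\<Sum>\<mu> = - int n..-1. c \<mu> *s complex_W n \<mu> x) + (\<Sum>\<mu> = 1..int n. c \<mu> *s complex_W n \<mu> x)"
      by (rule sum.union_disjoint) auto
    finally show ?thesis by simp
  qed
  also have "(\<Sum>\<mu> = - int n..-1. c \<mu> *s complex_W n \<mu> x) = (\<Sum>\<mu> = - int n..-1.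
       (1 / of_real (sqrt 2) * c \<mu>) *s (real_W n (- \<mu>) x - \<i> *s real_W n \<mu> x))"
    by (intro sum.cong refl complex_W_eq_real_W(1)[symmetric] x) auto
  also have "(\<Sum>\<mu> = 1..int n. c \<mu> *s complex_W n \<mu> x) = (\<Sum>\<mu> = 1..int n.
       ((-1) powi \<mu> / of_real (sqrt 2) * c \<mu>) *s (real_W n \<mu> x + \<i> *s real_W n (- \<mu>) x))"
    by (intro sum.cong refl complex_W_eq_real_W(2)[symmetric] x) auto
  also have "c 0 *s complex_W n 0 x = c 0 *s real_W n 0 x"
    by (rule complex_W_eq_real_W(3)[OF x, of 0, symmetric]) simp
  finally show ?thesis ..
qed

theorem theorem3p3:
  fixes r a r' :: "real ^ 3" and l :: nat and m :: int
  assumes "norm a > norm r" and "norm r > 0"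
    and "r' = r + a"
    and "\<bar>m\<bar> \<le> int l"
  shows
    "(\<lambda>N. \<Sum>\<Lambda> = 1..N. \<Sum>\<mu> = - int \<Lambda>..int \<Lambda>.
        (of_real (norm r ^ (\<Lambda> - 1)) * H_real l \<Lambda> m \<mu> a) *s complex_W \<Lambda> \<mu> (sgn r))
     \<longlonglongrightarrow> of_real (norm r' powi (- int l - 2)) *s real_V l m (sgn r')
   \<and>
     (\<lambda>N. \<Sum>\<Lambda> = 1..N. of_real (norm r ^ (\<Lambda> - 1)) *s
        ((\<Sum>\<mu> = - int \<Lambda>..-1. (1 / of_real (sqrt 2) * H_real l \<Lambda> m \<mu> a) *s
            (real_W \<Lambda> (- \<mu>) (sgn r) - \<i> *s real_W \<Lambda> \<mu> (sgn r)))
         + (\<Sum>\<mu> = 1..int \<Lambda>. ((-1) powi \<mu> / of_real (sqrt 2) * H_real l \<Lambda> m \<mu> a) *s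
            (real_W \<Lambda> \<mu> (sgn r) + \<i> *s real_W \<Lambda> (- \<mu>) (sgn r)))
         + H_real l \<Lambda> m 0 a *s real_W \<Lambda> 0 (sgn r)))
     \<longlonglongrightarrow> of_real (norm r' powi (- int l - 2)) *s real_V l m (sgn r')"
proof -
  let ?R = "of_real (norm r' powi (- int l - 2)) *s real_V l m (sgn r')"
  let ?f = "\<lambda>\<Lambda>. \<Sum>\<mu> = - int \<Lambda>..int \<Lambda>.
        (of_real (norm r ^ (\<Lambda> - 1)) * H_real l \<Lambda> m \<mu> a) *s complex_W \<Lambda> \<mu> (sgn r)"
  have r: "r \<noteq> 0" and m': "\<bar>- m\<bar> \<le> int l" using assms(2,4) by auto
  have r': "r' \<noteq> 0"
  proof
    assume "r' = 0"
    then have "a = - r" using assms(3) by (simp add: add_eq_0_iff)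
    then show False using assms(1) by simp
  qed
  have nr: "norm (sgn r) = 1" and nr': "norm (sgn r') = 1" using r r' by (simp_all add: norm_sgn)
  have lim: "(\<lambda>N. \<Sum>\<Lambda> = 1..N. ?f \<Lambda>) \<longlonglongrightarrow> ?R"
  proof (rule vec_tendstoI)
    fix i
    let ?t = "\<lambda>n k. \<Sum>\<mu> = - int (Suc n)..int (Suc n).
       of_real (norm r ^ n) * H_coeff l (Suc n) k \<mu> a * complex_W (Suc n) \<mu> (sgn r) $ i"
    have "(\<lambda>n. real_comb (?t n) m) sums
        real_comb (\<lambda>k. of_real (norm r' powi (- int l - 2)) * vec_V l (sph_harm l k) (sgn r') $ i) m"
      unfolding assms(3)
      by (rule real_comb_sums; rule complex_expansion[OF assms(1) r]) (use assms(4) m' in auto)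
    moreover have "real_comb (?t n) m = ?f (Suc n) $ i" for n
      unfolding real_comb_sum[symmetric] real_comb_mult[symmetric] real_comb_mult_right[symmetric]
        H_real_def sum_component vector_smult_component by simp
    moreover have "real_comb (\<lambda>k. of_real (norm r' powi (- int l - 2)) * vec_V l (sph_harm l k) (sgn r') $ i) m
        = ?R $ i"
      by (simp add: real_fields_nth(2)[OF nr' assms(4)] real_comb_mult)
    ultimately have "(\<lambda>n. ?f (Suc n) $ i) sums (?R $ i)" by (simp only:)
    then have "(\<lambda>N. \<Sum>n<N. ?f (Suc n) $ i) \<longlonglongrightarrow> ?R $ i" unfolding sums_def .
    moreover have "(\<Sum>n<N. ?f (Suc n) $ i) = (\<Sum>\<Lambda> = 1..N. ?f \<Lambda>) $ i" for N
      by (simp only: One_nat_def sum.atLeast1_atMost_eq sum_component)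
    ultimately show "(\<lambda>N. (\<Sum>\<Lambda> = 1..N. ?f \<Lambda>) $ i) \<longlonglongrightarrow> ?R $ i" by (simp only:)
  qed
  moreover have "of_real (norm r ^ (\<Lambda> - 1)) *s
        ((\<Sum>\<mu> = - int \<Lambda>..-1. (1 / of_real (sqrt 2) * H_real l \<Lambda> m \<mu> a) *s
            (real_W \<Lambda> (- \<mu>) (sgn r) - \<i> *s real_W \<Lambda> \<mu> (sgn r)))
         + (\<Sum>\<mu> = 1..int \<Lambda>. ((-1) powi \<mu> / of_real (sqrt 2) * H_real l \<Lambda> m \<mu> a) *s
            (real_W \<Lambda> \<mu> (sgn r) + \<i> *s real_W \<Lambda> (- \<mu>) (sgn r)))
         + H_real l \<Lambda> m 0 a *s real_W \<Lambda> 0 (sgn r)) = ?f \<Lambda>" for \<Lambda>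
    unfolding sum_complex_W_eq_real_W[where c = "\<lambda>\<mu>. H_real l \<Lambda> m \<mu> a", OF nr]
    by (simp add: vec_eq_iff sum_distrib_left mult.assoc)
  ultimately show ?thesis by (simp only:)
qed

end
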